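(* Consider the Sierpinski gasket $SG(n+m+1)$ with non-negative integers $n$ and $m$, and let the vertex $x_n$ be either $a_n$, $b_n$ or $c_n$. Then the limiting probabilities are $$\lim_{m\to\infty}F_1(n+m+1,x_n)=0,\quad \lim_{m\to\infty}F_2(n+m+1,x_n)=\frac{121}{196},\quad \lim_{m\to\infty}F_3(n+m+1,x_n)=\frac{33}{98},\quad \lim_{m\to\infty}F_4(n+m+1,x_n)=\frac{9}{196}.$$
   Context: The two-dimensional Sierpinski gasket graph $SG(n)$, $n\ge 0$, is drawn in the plane with three outmost vertices: leftmost $o$, rightmost $a_n$, topmost $b_n$. $SG(0)$ is a triangle (3 vertices, 3 edges). $SG(n+1)$ consists of three copies of $SG(n)$ (lower-left, lower-right, top), where the rightmost vertex of the lower-left copy is identified with the leftmost vertex of the lower-right copy, the topmost vertex of the lower-left copy with the leftmost vertex of the top copy, and the topmost vertex of the lower-right copy with the rightmost vertex of the top copy. For $k\le N$, $SG(k)$ is regarded as the sub-copy of $SG(N)$ containing the leftmost vertex $o$ (iterating the lower-left copy), so that $a_k$ and $b_k$ are vertices of every $SG(N)$ with $N\ge k$; $c_k$ denotes the vertex of $SG(k+1)$ shared by its lower-right and top copies of $SG(k)$, also regarded as a vertex of $SG(N)$ for $N\ge k+1$. $f(N)$ is the number of spanning trees of $SG(N)$, $f_j(N,x)$ is the number of those in which exactly $j$ tree edges are incident to the vertex $x$, and $F_j(N,x)=f_j(N,x)/f(N)$.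
   Formalization: For fixed n the stated limits as m→∞ fail (F_1(m+1,a_0) ≥ 1/128 for all m); proved instead: the limit as m→∞ exists for each n and tends to the stated value as n→∞, and F_j(n+m+1,x_n) tends to it as n→∞ uniformly in m. *)

theory Defs
  imports "HOL-Analysis.Analysis"
begin

text \<open>
  Vertices are given by oblique coordinates: the pair \<open>(p, q)\<close> is the point at
  \<open>p\<close> times the horizontal unit vector plus \<open>q\<close> times the unit vector at 60 degrees, so
  the outmost vertices of stage \<open>n\<close> are \<open>(0, 0)\<close>, \<open>(2 ^ n, 0)\<close> and \<open>(0, 2 ^ n)\<close>. The
  lower-right and the top copy of stage \<open>n\<close> inside stage \<open>n + 1\<close> are translates, and the
  three identifications of corners are then equalities of points (see \<open>sg_gluing\<close>).
  Since the lower-left copy is not moved, stage \<open>k\<close> is literally a subgraph of every later stage.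
\<close>

type_synonym vertex = "nat \<times> nat"

primrec sg_verts :: "nat \<Rightarrow> vertex set" where
  "sg_verts 0 = {(0, 0), (1, 0), (0, 1)}"
| "sg_verts (Suc n) = sg_verts n \<union> (+) (2 ^ n, 0) ` sg_verts n \<union> (+) (0, 2 ^ n) ` sg_verts n"

primrec sg_edges :: "nat \<Rightarrow> vertex set set" where
  "sg_edges 0 = {{(0, 0), (1, 0)}, {(0, 0), (0, 1)}, {(1, 0), (0, 1)}}"
| "sg_edges (Suc n) = sg_edges n \<union> (`) ((+) (2 ^ n, 0)) ` sg_edges n
                       \<union> (`) ((+) (0, 2 ^ n)) ` sg_edges n"

definition a_vertex :: "nat \<Rightarrow> vertex" where "a_vertex n = (2 ^ n, 0)"
definition b_vertex :: "nat \<Rightarrow> vertex" where "b_vertex n = (0, 2 ^ n)"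
definition c_vertex :: "nat \<Rightarrow> vertex" where "c_vertex n = (2 ^ n, 2 ^ n)"

definition connected_graph :: "'v set \<Rightarrow> 'v set set \<Rightarrow> bool" where
  "connected_graph V E \<longleftrightarrow> V \<noteq> {} \<and> (\<forall>u\<in>V. \<forall>v\<in>V. (u, v) \<in> {(s, t). {s, t} \<in> E}\<^sup>*)"

definition is_cycle :: "'v set set \<Rightarrow> 'v list \<Rightarrow> bool" where
  "is_cycle E p \<longleftrightarrow> 3 \<le> length p \<and> distinct p \<and>
     (\<forall>i<length p. {p ! i, p ! (Suc i mod length p)} \<in> E)"

definition spanning_trees :: "'v set \<Rightarrow> 'v set set \<Rightarrow> 'v set set set" where
  "spanning_trees V E = {T. T \<subseteq> E \<and> connected_graph V T \<and> \<not> (\<exists>p. is_cycle T p)}"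

definition tree_count :: "nat \<Rightarrow> nat" where
  "tree_count N = card (spanning_trees (sg_verts N) (sg_edges N))"

definition tree_count_deg :: "nat \<Rightarrow> nat \<Rightarrow> vertex \<Rightarrow> nat" where
  "tree_count_deg j N x = card {T \<in> spanning_trees (sg_verts N) (sg_edges N). card {e \<in> T. x \<in> e} = j}"

definition deg_prob :: "nat \<Rightarrow> nat \<Rightarrow> vertex \<Rightarrow> real" where
  "deg_prob j N x = real (tree_count_deg j N x) / real (tree_count N)"

lemma sg_verts_bound: "v \<in> sg_verts n \<Longrightarrow> fst v + snd v \<le> 2 ^ n"
proof (induction n arbitrary: v)
  case 0
  then show ?case by auto
next
  case (Suc n)
  then consider "v \<in> sg_verts n" | w where "w \<in> sg_verts n" "v = (2 ^ n, 0) + w"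
    | w where "w \<in> sg_verts n" "v = (0, 2 ^ n) + w"
    by auto
  then show ?case
    by cases (auto dest!: Suc.IH)
qed

lemma sg_corners: "(0, 0) \<in> sg_verts n" "(2 ^ n, 0) \<in> sg_verts n" "(0, 2 ^ n) \<in> sg_verts n"
proof (induction n)
  case (Suc n)
  have "(2 ^ n, 0) + (2 ^ n, 0) \<in> sg_verts (Suc n)" "(0, 2 ^ n) + (0, 2 ^ n) \<in> sg_verts (Suc n)"
    using Suc.IH by (simp_all del: add_Pair)
  then show "(2 ^ Suc n, 0) \<in> sg_verts (Suc n)" "(0, 2 ^ Suc n) \<in> sg_verts (Suc n)"
    by (simp_all add: mult_2)
  show "(0, 0) \<in> sg_verts (Suc n)"
    using Suc.IH by simp
qed simp_all

lemma sg_edges_verts: "\<Union> (sg_edges n) = sg_verts n"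
proof (induction n)
  case (Suc n)
  have "\<Union> ((`) g ` sg_edges n) = g ` sg_verts n" for g :: "vertex \<Rightarrow> vertex"
    unfolding Suc.IH[symmetric] by blast
  then show ?case
    by (simp add: Suc.IH)
qed auto

lemma sg_gluing:
  "sg_verts n \<inter> (+) (2 ^ n, 0) ` sg_verts n = {a_vertex n}"
  "sg_verts n \<inter> (+) (0, 2 ^ n) ` sg_verts n = {b_vertex n}"
  "(+) (2 ^ n, 0) ` sg_verts n \<inter> (+) (0, 2 ^ n) ` sg_verts n = {c_vertex n}"
proof -
  note c = sg_corners[of n]
  have "(2 ^ n, 0) + (0, 0) \<in> (+) (2 ^ n, 0) ` sg_verts n"
    "(2 ^ n, 0) + (0, 2 ^ n) \<in> (+) (2 ^ n, 0) ` sg_verts n"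
    "(0, 2 ^ n) + (0, 0) \<in> (+) (0, 2 ^ n) ` sg_verts n"
    "(0, 2 ^ n) + (2 ^ n, 0) \<in> (+) (0, 2 ^ n) ` sg_verts n"
    using c by blast+
  then have d: "(2 ^ n, 0) \<in> (+) (2 ^ n, 0) ` sg_verts n"
    "(2 ^ n, 2 ^ n) \<in> (+) (2 ^ n, 0) ` sg_verts n"
    "(0, 2 ^ n) \<in> (+) (0, 2 ^ n) ` sg_verts n"
    "(2 ^ n, 2 ^ n) \<in> (+) (0, 2 ^ n) ` sg_verts n"
    by simp_all
  have e: "2 ^ n \<le> fst v \<and> fst v + snd v \<le> 2 ^ n + 2 ^ n" if "v \<in> (+) (2 ^ n, 0) ` sg_verts n" for v
    using that sg_verts_bound by force
  have h: "2 ^ n \<le> snd v \<and> fst v + snd v \<le> 2 ^ n + 2 ^ n" if "v \<in> (+) (0, 2 ^ n) ` sg_verts n" for v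
    using that sg_verts_bound by force
  have "v = (2 ^ n, 0)" if "v \<in> sg_verts n \<inter> (+) (2 ^ n, 0) ` sg_verts n" for v
    using that e[of v] sg_verts_bound[of v n] by (cases v) auto
  then show "sg_verts n \<inter> (+) (2 ^ n, 0) ` sg_verts n = {a_vertex n}"
    using c d unfolding a_vertex_def by blast
  have "v = (0, 2 ^ n)" if "v \<in> sg_verts n \<inter> (+) (0, 2 ^ n) ` sg_verts n" for v
    using that h[of v] sg_verts_bound[of v n] by (cases v) auto
  then show "sg_verts n \<inter> (+) (0, 2 ^ n) ` sg_verts n = {b_vertex n}"
    using c d unfolding b_vertex_def by blast
  have "v = (2 ^ n, 2 ^ n)"
    if "v \<in> (+) (2 ^ n, 0) ` sg_verts n \<inter> (+) (0, 2 ^ n) ` sg_verts n" for v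
    using that e[of v] h[of v] by (cases v) auto
  then show "(+) (2 ^ n, 0) ` sg_verts n \<inter> (+) (0, 2 ^ n) ` sg_verts n = {c_vertex n}"
    using c d unfolding c_vertex_def by blast
qed

end

(* Cut along its three corners, a gasket only matters to its surroundings through the partition of the
   corners induced by a spanning forest (five types). By electrical equivalence with a star, the numbers
   of forests of the five types stay in a fixed shape up to a scale r that disappears from the gluing
   rules, so the degree statistics of a vertex, normalised by type, are transformed from stage to stage
   by fixed stochastic matrices. All types give positive weight to the joined type in each copy, so
   these matrices contract oscillations by 9/10, and the degree of a corner becomes independent of the
   type, with limiting probabilities 11/14 (degree 1) and 3/14 (degree 2). At a junction of two copies
   the two corner degrees become independent, whence (11/14)^2, 2 (11/14)(3/14), (3/14)^2; afterwards
   stochastic averaging cannot leave an interval around these values, so the limit is uniform in m. *)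

theory Submission
  imports Defs "HOL-Computational_Algebra.Polynomial"
begin

section \<open>Connectivity and spanning trees\<close>

text \<open>With \<open>n\<close> fixed, the stated values are in general not limits in
  \<open>m\<close>: in SG(1) some spanning trees have degree 1 at \<open>a_0\<close>, and the limit
  in \<open>m\<close> of \<open>F_1\<close> at \<open>a_0\<close>, a stationary average of
  nonnegative stage-1 values in which the joined type has weight 9/14, is therefore positive. The
  values 0, 121/196, 33/98, 9/196 emerge only as \<open>n\<close> grows, so every estimate has an
  error depending on \<open>n\<close> and the degree but not on \<open>m\<close>. A cycle may run
  through all three copies, which makes acyclicity awkward to cut and glue. It is replaced by an
  edge count, edges plus blocks equal vertices, which is additive up to the three identified
  vertices. Origin of the constants: the joined type has share at least 1/10 in the law of the type
  of any single copy, hence 9/10. For a corner, the stationary weights are 9/14 for the joined type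
  and 5/28 for each of the two other types in which this corner is not isolated. In a triangle the
  corner has degree 1 with probability 2/3 for the joined type and 1 for those two, so 9/14 * 2/3 +
  5/14 = 11/14.\<close>

definition conn :: "'v set set \<Rightarrow> ('v \<times> 'v) set" where
  "conn T = {(s, t). {s, t} \<in> T}\<^sup>*"

lemma conn_refl [simp]: "(u, u) \<in> conn T"
  by (simp add: conn_def)

lemma conn_trans: "(u, v) \<in> conn T \<Longrightarrow> (v, w) \<in> conn T \<Longrightarrow> (u, w) \<in> conn T"
  by (simp add: conn_def)

lemma conn_edge: "{u, v} \<in> T \<Longrightarrow> (u, v) \<in> conn T"
  by (auto simp: conn_def)

lemma conn_sym: "(u, v) \<in> conn T \<Longrightarrow> (v, u) \<in> conn T"
proof -
  have "sym {(s, t). {s, t} \<in> T}"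
    by (auto simp: sym_def insert_commute)
  then show "(u, v) \<in> conn T \<Longrightarrow> (v, u) \<in> conn T"
    unfolding conn_def by (metis sym_rtrancl symD)
qed

lemma conn_commute: "(u, v) \<in> conn T \<longleftrightarrow> (v, u) \<in> conn T"
  using conn_sym by metis

lemma conn_mono: "(u, v) \<in> conn S \<Longrightarrow> S \<subseteq> T \<Longrightarrow> (u, v) \<in> conn T"
  unfolding conn_def by (erule rtrancl_mono[THEN subsetD, rotated]) auto

lemma conn_induct [consumes 1, case_names refl step]:
  assumes "(u, v) \<in> conn T" "P u"
    and "\<And>s t. (u, s) \<in> conn T \<Longrightarrow> {s, t} \<in> T \<Longrightarrow> P s \<Longrightarrow> P t"
  shows "P v"
  using assms(1)[unfolded conn_def] assms(2,3)
  by (induction rule: rtrancl_induct) (auto simp: conn_def)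

lemma conn_closed:
  assumes "(u, v) \<in> conn T" "u \<in> A" "\<And>s t. {s, t} \<in> T \<Longrightarrow> s \<in> A \<Longrightarrow> t \<in> A"
  shows "v \<in> A"
  using assms(1) by (induction rule: conn_induct) (use assms in auto)

text \<open>Repeated passages over the added edge can be shortcut, so only a single crossing, in one
  of the two directions, has to be considered.\<close>

lemma conn_insert_cases:
  assumes "(v, c) \<in> conn (insert {u, w} T)"
  shows "(v, c) \<in> conn T \<or> ((v, u) \<in> conn T \<and> (w, c) \<in> conn T)
    \<or> ((v, w) \<in> conn T \<and> (u, c) \<in> conn T)"
  using assms
proof (induction rule: conn_induct)
  case refl
  then show ?case by simp
next
  case (step s t)
  show ?case
  proof (cases "{s, t} \<in> T")
    case True
    then show ?thesis
      using step.IH conn_edge conn_trans by metis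
  next
    case False
    then have "{s, t} = {u, w}" using step by auto
    then consider "s = u" "t = w" | "s = w" "t = u"
      by (auto simp: doubleton_eq_iff)
    then show ?thesis
      using step.IH by cases auto
  qed
qed

text \<open>Think of \<open>C\<close> as meeting every component. Deleting an edge splits at most
  one component and so costs at most one further representative; without edges \<open>C\<close> must
  contain all of \<open>V\<close>.\<close>

lemma card_le_card_edges_plus:
  assumes "finite T" "\<And>e. e \<in> T \<Longrightarrow> \<exists>u w. e = {u, w}" "finite V" "finite C"
    and "\<And>v. v \<in> V \<Longrightarrow> \<exists>c\<in>C. (v, c) \<in> conn T"
  shows "card V \<le> card T + card C"
  using assms
proof (induction T arbitrary: C rule: finite_induct)
  case empty
  have "v \<in> C" if v: "v \<in> V" for v
  proof -
    obtain c where "c \<in> C" "(v, c) \<in> conn {}" using empty v by blast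
    then show ?thesis by (simp add: conn_def)
  qed
  then show ?case
    using card_mono empty by (metis add_0 card.empty subsetI)
next
  case (insert e T)
  obtain u w where e: "e = {u, w}" using insert.prems(1) by blast
  have "\<exists>x. \<forall>v\<in>V. \<exists>c\<in>insert x C. (v, c) \<in> conn T"
  \<comment> \<open>If \<open>w\<close> keeps a representative, only vertices joined to
    \<open>u\<close> can lose theirs, so \<open>u\<close> is added. Otherwise no crossing can arrive
    at \<open>w\<close> and continue to \<open>C\<close>, and adding \<open>w\<close>
    suffices.\<close>
  proof (cases "\<exists>c\<in>C. (w, c) \<in> conn T")
    case True
    then obtain c' where c': "c' \<in> C" "(w, c') \<in> conn T" by blast
    show ?thesis
    proof (intro exI ballI)
      fix v assume "v \<in> V"
      then obtain c where c: "c \<in> C" "(v, c) \<in> conn (insert {u, w} T)"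
        using insert.prems(4) e by blast
      show "\<exists>c\<in>insert u C. (v, c) \<in> conn T"
        using conn_insert_cases[OF c(2)]
      proof (elim disjE conjE)
        assume "(v, w) \<in> conn T"
        then show ?thesis using conn_trans c' by (metis insertCI)
      qed (use c in auto)
    qed
  next
    case False
    show ?thesis
    proof (intro exI ballI)
      fix v assume "v \<in> V"
      then obtain c where c: "c \<in> C" "(v, c) \<in> conn (insert {u, w} T)"
        using insert.prems(4) e by blast
      show "\<exists>c\<in>insert w C. (v, c) \<in> conn T"
        using conn_insert_cases[OF c(2)] False c(1) by blast
    qed
  qed
  then obtain x where x: "\<And>v. v \<in> V \<Longrightarrow> \<exists>c\<in>insert x C. (v, c) \<in> conn T" by blast
  have "card V \<le> card T + card (insert x C)"
    by (rule insert.IH) (use insert.prems x in auto)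
  also have "\<dots> \<le> card T + (card C + 1)"
    using insert.prems by (simp add: card_insert_if)
  finally show ?case
    using insert.hyps by simp
qed

text \<open>Loops are erased while the walk is built: on returning to a visited vertex the path is
  cut back to it.\<close>

lemma conn_simple_path:
  assumes "(u, w) \<in> conn T"
  shows "\<exists>p. p \<noteq> [] \<and> hd p = u \<and> last p = w \<and> distinct p \<and> successively (\<lambda>s t. {s, t} \<in> T) p"
  using assms
proof (induction rule: conn_induct)
  case refl
  then show ?case by (intro exI[of _ "[u]"]) simp
next
  case (step s t)
  then obtain p where p: "p \<noteq> []" "hd p = u" "last p = s" "distinct p"
    "successively (\<lambda>s t. {s, t} \<in> T) p" by blast
  show ?case
  proof (cases "t \<in> set p")
    case True
    then obtain p1 p2 where "p = p1 @ t # p2" by (meson split_list)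
    then show ?thesis
      using p by (intro exI[of _ "p1 @ [t]"]) (auto simp: successively_append_iff hd_append)
  next
    case False
    then show ?thesis
      using p step by (intro exI[of _ "p @ [t]"]) (auto simp: successively_append_iff)
  qed
qed

lemma is_cycle_mono: "is_cycle S p \<Longrightarrow> S \<subseteq> T \<Longrightarrow> is_cycle T p"
  unfolding is_cycle_def by blast

lemma conn_insert_cycle:
  assumes "(u, w) \<in> conn T" "u \<noteq> w" "{u, w} \<notin> T"
  shows "\<exists>p. is_cycle (insert {u, w} T) p"
proof -
  obtain p where p: "p \<noteq> []" "hd p = u" "last p = w" "distinct p"
    "successively (\<lambda>s t. {s, t} \<in> T) p" using conn_simple_path[OF assms(1)] by blast
  have nth: "p ! 0 = u" "p ! (length p - 1) = w"
    using p by (simp_all add: hd_conv_nth last_conv_nth)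
  have suc: "{p ! i, p ! Suc i} \<in> T" if "Suc i < length p" for i
    using p(5) that by (simp add: successively_conv_nth)
  \<comment> \<open>Length 1 would give \<open>u = w\<close>, and length 2 would put
    \<open>{u, w}\<close> into \<open>T\<close>.\<close>
  have "length p \<noteq> 0" "length p \<noteq> 1" using p nth assms by auto
  moreover have "length p \<noteq> 2" using nth suc[of 0] assms by auto
  ultimately have len: "3 \<le> length p" by linarith
  have "{p ! i, p ! (Suc i mod length p)} \<in> insert {u, w} T" if "i < length p" for i
  proof (cases "Suc i < length p")
    case True
    then show ?thesis using suc by simp
  next
    case False
    then have "i = length p - 1" "Suc i = length p" using that by auto
    then show ?thesis using nth by (simp add: insert_commute)
  qed
  then show ?thesis using len p(4) unfolding is_cycle_def by blast
qed

text \<open>Going round the cycle the other way avoids its first edge.\<close>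

lemma cycle_edge_conn:
  assumes "is_cycle T p"
  shows "{p ! 0, p ! 1} \<in> T" "(p ! 1, p ! 0) \<in> conn (T - {{p ! 0, p ! 1}})"
proof -
  let ?T = "T - {{p ! 0, p ! 1}}"
  have len: "3 \<le> length p" and dist: "distinct p"
    and e: "\<And>i. i < length p \<Longrightarrow> {p ! i, p ! (Suc i mod length p)} \<in> T"
    using assms unfolding is_cycle_def by blast+
  show "{p ! 0, p ! 1} \<in> T"
  proof -
    have "0 < length p" "1 mod length p = 1" using len by auto
    then show ?thesis using e[of 0] by simp
  qed
  have eq: "p ! i = p ! j \<longleftrightarrow> i = j" if "i < length p" "j < length p" for i j
    using dist that by (simp add: nth_eq_iff_index_eq)
  have l: "0 < length p" "1 < length p" using len by auto
  have walk: "(p ! 1, p ! Suc i) \<in> conn ?T" if "Suc i < length p" for i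
    using that
  proof (induction i)
    case 0
    then show ?case by simp
  next
    case (Suc i)
    have "{p ! Suc i, p ! Suc (Suc i)} \<in> T" using e[of "Suc i"] Suc by simp
    moreover have "{p ! Suc i, p ! Suc (Suc i)} \<noteq> {p ! 0, p ! 1}"
      unfolding doubleton_eq_iff using Suc l by (simp add: eq)
    ultimately have "(p ! Suc i, p ! Suc (Suc i)) \<in> conn ?T"
      by (intro conn_edge) simp
    then show ?case using Suc conn_trans by (metis Suc_lessD)
  qed
  have "Suc (length p - 1) = length p" using len by linarith
  then have "{p ! (length p - 1), p ! 0} \<in> T" using e[of "length p - 1"] l by simp
  moreover have "{p ! (length p - 1), p ! 0} \<noteq> {p ! 0, p ! 1}"
    unfolding doubleton_eq_iff using len l by (simp add: eq)
  ultimately have "(p ! (length p - 1), p ! 0) \<in> conn ?T"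
    by (intro conn_edge) simp
  moreover have "(p ! 1, p ! (length p - 1)) \<in> conn ?T"
    using walk[of "length p - 2"] len by (simp add: numeral_2_eq_2 Suc_diff_Suc)
  ultimately show "(p ! 1, p ! 0) \<in> conn ?T" using conn_trans by metis
qed

lemma acyclic_representatives:
  assumes "finite T" "\<And>e. e \<in> T \<Longrightarrow> \<exists>u w. e = {u, w} \<and> u \<noteq> w \<and> u \<in> V \<and> w \<in> V" "finite V"
    and "\<nexists>p. is_cycle T p"
  shows "\<exists>C\<subseteq>V. (\<forall>v\<in>V. \<exists>c\<in>C. (v, c) \<in> conn T) \<and> card T + card C \<le> card V"
  using assms
proof (induction T rule: finite_induct)
  case empty
  show ?case by (rule exI[of _ V]) (auto intro: conn_refl)
next
  case (insert e T)
  obtain u w where e: "e = {u, w}" "u \<noteq> w" "u \<in> V" "w \<in> V" using insert.prems(1) by blast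
  have "\<nexists>p. is_cycle T p" using insert.prems(3) is_cycle_mono[of T _ "insert e T"] by blast
  then have "\<exists>C\<subseteq>V. (\<forall>v\<in>V. \<exists>c\<in>C. (v, c) \<in> conn T) \<and> card T + card C \<le> card V"
    by (intro insert.IH insert.prems(1,2)) auto
  then obtain C where C: "C \<subseteq> V" "\<And>v. v \<in> V \<Longrightarrow> \<exists>c\<in>C. (v, c) \<in> conn T"
    "card T + card C \<le> card V" by blast
  have fin: "finite C" using C insert.prems(2) finite_subset by blast
  have uw: "(u, w) \<notin> conn T" using conn_insert_cycle[of u w T] e insert.prems(3) insert.hyps by auto
  obtain cu where cu: "cu \<in> C" "(u, cu) \<in> conn T" using C e by blast
  obtain cw where cw: "cw \<in> C" "(w, cw) \<in> conn T" using C e by blast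
  have ne: "cu \<noteq> cw" using uw cu cw conn_trans conn_sym by metis
  have sub: "T \<subseteq> insert e T" by blast
  have "(cw, w) \<in> conn (insert e T)" "(w, u) \<in> conn (insert e T)" "(u, cu) \<in> conn (insert e T)"
    using conn_mono[OF conn_sym[OF cw(2)] sub] conn_mono[OF cu(2) sub] conn_edge[of w u] e
    by (auto simp: insert_commute)
  then have "(cw, cu) \<in> conn (insert e T)" using conn_trans by metis
  then have "\<exists>c\<in>C - {cw}. (v, c) \<in> conn (insert e T)" if v: "v \<in> V" for v
  proof -
    obtain c where c: "c \<in> C" "(v, c) \<in> conn T" using C(2)[OF v] by blast
    have vc: "(v, c) \<in> conn (insert e T)" using conn_mono[OF c(2) sub] .
    show ?thesis
    proof (cases "c = cw")
      case True
      then have "(v, cu) \<in> conn (insert e T)"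
        using conn_trans[OF vc] \<open>(cw, cu) \<in> conn (insert e T)\<close> by simp
      then show ?thesis using cu(1) ne by blast
    next
      case False
      then show ?thesis using c(1) vc by blast
    qed
  qed
  moreover have "card (insert e T) + card (C - {cw}) \<le> card V"
  proof -
    have "card C > 0" using cw fin by (auto simp: card_gt_0_iff)
    then show ?thesis using C(3) insert.hyps cw fin by simp
  qed
  ultimately show ?case using C(1) by (intro exI[of _ "C - {cw}"]) auto
qed

text \<open>This trades cycles for an edge count. Connectedness needs at least
  \<open>card V - 1\<close> edges and acyclicity allows at most that many; conversely, an edge of a
  cycle could be deleted without disconnecting, which would leave one edge too few.\<close>

lemma spanning_trees_iff:
  assumes "finite V" "r \<in> V" "\<And>e. e \<in> E \<Longrightarrow> \<exists>u w. e = {u, w} \<and> u \<noteq> w \<and> u \<in> V \<and> w \<in> V" "finite E"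
  shows "T \<in> spanning_trees V E \<longleftrightarrow>
    T \<subseteq> E \<and> (\<forall>v\<in>V. (v, r) \<in> conn T) \<and> card T + 1 = card V"
proof -
  have conn_iff: "connected_graph V T \<longleftrightarrow> (\<forall>v\<in>V. (v, r) \<in> conn T)"
    unfolding connected_graph_def conn_def[symmetric]
  proof
    assume "V \<noteq> {} \<and> (\<forall>u\<in>V. \<forall>v\<in>V. (u, v) \<in> conn T)"
    then show "\<forall>v\<in>V. (v, r) \<in> conn T" using assms(2) by blast
  next
    assume r: "\<forall>v\<in>V. (v, r) \<in> conn T"
    have "(u, v) \<in> conn T" if "u \<in> V" "v \<in> V" for u v
      using conn_trans[of u r T v] conn_sym[of v r T] r that by simp
    then show "V \<noteq> {} \<and> (\<forall>u\<in>V. \<forall>v\<in>V. (u, v) \<in> conn T)" using assms(2) by blast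
  qed
  have "(\<nexists>p. is_cycle T p) \<longleftrightarrow> card T + 1 = card V"
    if T: "T \<subseteq> E" and con: "\<And>v. v \<in> V \<Longrightarrow> (v, r) \<in> conn T"
  proof
    have fT: "finite T" using T assms finite_subset by blast
    have V_le: "card V \<le> card S + 1" if "S \<subseteq> T" "\<And>v. v \<in> V \<Longrightarrow> (v, r) \<in> conn S" for S
    proof -
      have "finite S" using that fT finite_subset by blast
      then have "card V \<le> card S + card {r}"
      proof (rule card_le_card_edges_plus)
        show "\<exists>u w. e = {u, w}" if "e \<in> S" for e
          using assms(3)[of e] T \<open>S \<subseteq> T\<close> that by blast
      qed (use that assms in auto)
      then show ?thesis by simp
    qed
    {
      assume "\<nexists>p. is_cycle T p"
      then have "\<exists>C\<subseteq>V. (\<forall>v\<in>V. \<exists>c\<in>C. (v, c) \<in> conn T) \<and> card T + card C \<le> card V"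
        by (intro acyclic_representatives[OF fT] assms(1)) (use assms(3) T in auto)
      then obtain C where C: "C \<subseteq> V" "\<forall>v\<in>V. \<exists>c\<in>C. (v, c) \<in> conn T" "card T + card C \<le> card V"
        by blast
      then have "C \<noteq> {}" "finite C" using assms(1,2) finite_subset by blast+
      then have "card C \<ge> 1" by (simp add: Suc_le_eq card_gt_0_iff)
      then show "card T + 1 = card V" using C V_le[of T] con by simp
    }
    {
      assume eq: "card T + 1 = card V"
      show "\<nexists>p. is_cycle T p"
      proof
        assume "\<exists>p. is_cycle T p"
        then obtain p where "is_cycle T p" by blast
        note p = cycle_edge_conn[OF this]
        let ?S = "T - {{p ! 0, p ! 1}}"
        have ins: "insert {p ! 0, p ! 1} ?S = T" using p by blast
        have "(v, r) \<in> conn ?S" if "v \<in> V" for v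
          using conn_insert_cases[of v r "p ! 0" "p ! 1" ?S] con[OF that] p(2)
          unfolding ins by (metis conn_sym conn_trans)
        then have "card V \<le> card ?S + 1" by (intro V_le) auto
        then show False using eq p fT card_Diff1_less[OF fT p(1)] by simp
      qed
    }
  qed
  then show ?thesis
    unfolding spanning_trees_def using conn_iff by blast
qed

section \<open>Gluing three graphs at their corners\<close>

text \<open>A spanning forest all of whose components meet the three corners induces a partition of the
  corners: all joined, only corner 0, 1 or 2 apart from the other two, or all apart. The corners 0, 1, 2
  of a gasket are the leftmost, the rightmost and the topmost vertex.\<close>

datatype ctype = Joined | Apart0 | Apart1 | Apart2 | Discrete

primrec joins01 :: "ctype \<Rightarrow> bool" where
  "joins01 Joined = True" | "joins01 Apart0 = False" | "joins01 Apart1 = False"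
| "joins01 Apart2 = True" | "joins01 Discrete = False"

primrec joins02 :: "ctype \<Rightarrow> bool" where
  "joins02 Joined = True" | "joins02 Apart0 = False" | "joins02 Apart1 = True"
| "joins02 Apart2 = False" | "joins02 Discrete = False"

primrec joins12 :: "ctype \<Rightarrow> bool" where
  "joins12 Joined = True" | "joins12 Apart0 = True" | "joins12 Apart1 = False"
| "joins12 Apart2 = False" | "joins12 Discrete = False"

lemma UNIV_ctype: "UNIV = {Joined, Apart0, Apart1, Apart2, Discrete}"
  using ctype.exhaust by blast

lemma finite_ctype: "finite (S :: ctype set)"
  by (rule finite_subset[OF subset_UNIV]) (simp add: UNIV_ctype)

lemma all_ctype: "(\<forall>t. P t) \<longleftrightarrow> P Joined \<and> P Apart0 \<and> P Apart1 \<and> P Apart2 \<and> P Discrete"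
proof (intro iffI allI)
  fix t
  assume "P Joined \<and> P Apart0 \<and> P Apart1 \<and> P Apart2 \<and> P Discrete"
  then show "P t" by (cases t) simp_all
qed simp

primrec blocks :: "ctype \<Rightarrow> nat" where
  "blocks Joined = 1" | "blocks Apart0 = 2" | "blocks Apart1 = 2"
| "blocks Apart2 = 2" | "blocks Discrete = 3"

definition has_type :: "'v set set \<Rightarrow> 'v \<Rightarrow> 'v \<Rightarrow> 'v \<Rightarrow> ctype \<Rightarrow> bool" where
  "has_type T p q r t \<longleftrightarrow> ((p, q) \<in> conn T \<longleftrightarrow> joins01 t) \<and> ((p, r) \<in> conn T \<longleftrightarrow> joins02 t)
     \<and> ((q, r) \<in> conn T \<longleftrightarrow> joins12 t)"

definition covers :: "'v set \<Rightarrow> 'v set set \<Rightarrow> 'v \<Rightarrow> 'v \<Rightarrow> 'v \<Rightarrow> bool" where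
  "covers V T p q r \<longleftrightarrow> (\<forall>v\<in>V. (p, v) \<in> conn T \<or> (q, v) \<in> conn T \<or> (r, v) \<in> conn T)"

text \<open>By \<open>covers\<close> and \<open>has_type\<close> there are exactly
  \<open>blocks t\<close> components on \<open>V\<close>; the count then excludes cycles, because
  edges plus components exceed the vertices as soon as there is one.\<close>

definition forests :: "'v set \<Rightarrow> 'v set set \<Rightarrow> 'v \<Rightarrow> 'v \<Rightarrow> 'v \<Rightarrow> ctype \<Rightarrow> 'v set set set" where
  "forests V E p q r t =
     {T. T \<subseteq> E \<and> covers V T p q r \<and> has_type T p q r t \<and> card T + blocks t = card V}"

definition simple_graph :: "'v set \<Rightarrow> 'v set set \<Rightarrow> bool" where
  "simple_graph V E \<longleftrightarrow> finite V \<and> (\<forall>e\<in>E. \<exists>u w. e = {u, w} \<and> u \<noteq> w \<and> u \<in> V \<and> w \<in> V)"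

lemma simple_graph_edgeE:
  assumes "simple_graph V E" "e \<in> E"
  obtains u w where "e = {u, w}" "u \<noteq> w" "u \<in> V" "w \<in> V"
  using assms unfolding simple_graph_def by meson

lemma simple_graph_finite: "simple_graph V E \<Longrightarrow> finite V" "simple_graph V E \<Longrightarrow> finite E"
proof -
  assume g: "simple_graph V E"
  then show "finite V" by (simp add: simple_graph_def)
  moreover have "E \<subseteq> Pow V"
  proof
    fix e assume "e \<in> E"
    then show "e \<in> Pow V" by (rule simple_graph_edgeE[OF g]) simp
  qed
  ultimately show "finite E" by (simp add: finite_subset)
qed

text \<open>Of the eight truth patterns for the three pairs of corners, transitivity leaves
  five.\<close>

lemma has_type_ex: "\<exists>t. has_type T p q r t"
proof -
  have "((p, q) \<in> conn T \<and> (p, r) \<in> conn T \<longrightarrow> (q, r) \<in> conn T)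
    \<and> ((p, q) \<in> conn T \<and> (q, r) \<in> conn T \<longrightarrow> (p, r) \<in> conn T)
    \<and> ((p, r) \<in> conn T \<and> (q, r) \<in> conn T \<longrightarrow> (p, q) \<in> conn T)"
    by (metis conn_sym conn_trans)
  then have "has_type T p q r Joined \<or> has_type T p q r Apart0 \<or> has_type T p q r Apart1
    \<or> has_type T p q r Apart2 \<or> has_type T p q r Discrete"
    unfolding has_type_def
    by (cases "(p, q) \<in> conn T"; cases "(p, r) \<in> conn T"; cases "(q, r) \<in> conn T") simp_all
  then show ?thesis by blast
qed

lemma has_type_unique: "has_type T p q r s \<Longrightarrow> has_type T p q r t \<Longrightarrow> s = t"
  unfolding has_type_def by (cases s; cases t; simp)

text \<open>The edge bound \<open>card_le_card_edges_plus\<close>, with one corner chosen from each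
  block as representative.\<close>

lemma card_le_covers:
  assumes "simple_graph V E" "T \<subseteq> E" "covers V T p q r" "has_type T p q r t"
  shows "card V \<le> card T + blocks t"
proof -
  define C where "C = (case t of Joined \<Rightarrow> {p} | Apart0 \<Rightarrow> {p, q} | Apart1 \<Rightarrow> {p, q}
    | Apart2 \<Rightarrow> {p, r} | Discrete \<Rightarrow> {p, q, r})"
  have "card C \<le> blocks t" "finite C"
    by (cases t; simp add: C_def card_insert_if)+
  moreover have "card V \<le> card T + card C"
  proof (rule card_le_card_edges_plus)
    show "finite T" "finite V"
      using simple_graph_finite[OF assms(1)] assms(2) finite_subset by auto
    show "\<exists>u w. e = {u, w}" if "e \<in> T" for e
      using that assms(1,2) simple_graph_edgeE by (metis subsetD)
    fix v assume "v \<in> V"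
    then have cov: "(v, p) \<in> conn T \<or> (v, q) \<in> conn T \<or> (v, r) \<in> conn T"
      using assms(3) unfolding covers_def by (metis conn_sym)
    show "\<exists>c\<in>C. (v, c) \<in> conn T"
    proof (cases t)
      case Joined
      then have "(q, p) \<in> conn T" "(r, p) \<in> conn T"
        using assms(4) by (auto simp: has_type_def intro: conn_sym)
      then show ?thesis using Joined cov conn_trans unfolding C_def by fastforce
    next
      case Apart0
      then have "(r, q) \<in> conn T"
        using assms(4) by (auto simp: has_type_def intro: conn_sym)
      then show ?thesis using Apart0 cov conn_trans unfolding C_def by fastforce
    next
      case Apart1
      then have "(r, p) \<in> conn T"
        using assms(4) by (auto simp: has_type_def intro: conn_sym)
      then show ?thesis using Apart1 cov conn_trans unfolding C_def by fastforce
    next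
      case Apart2
      then have "(q, p) \<in> conn T"
        using assms(4) by (auto simp: has_type_def intro: conn_sym)
      then show ?thesis using Apart2 cov conn_trans unfolding C_def by fastforce
    next
      case Discrete
      then show ?thesis using cov unfolding C_def by auto
    qed
  qed (use \<open>finite C\<close> in auto)
  ultimately show ?thesis by simp
qed

text \<open>Here \<open>t1\<close>, \<open>t2\<close>, \<open>t3\<close> are the types in the lower-left, the lower-right and the top copy. The
  first three conjuncts read off which outer corners get joined, the last three say that each of the
  three junctions is connected to an outer corner. Acyclicity is the separate block count in
  \<open>glue_set\<close>.\<close>

definition glues :: "ctype \<Rightarrow> ctype \<Rightarrow> ctype \<Rightarrow> ctype \<Rightarrow> bool" where
  "glues t t1 t2 t3 \<longleftrightarrow>
    (joins01 t \<longleftrightarrow> joins01 t1 \<and> joins01 t2 \<or> joins02 t1 \<and> joins01 t3 \<and> joins12 t2) \<and>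
    (joins02 t \<longleftrightarrow> joins02 t1 \<and> joins02 t3 \<or> joins01 t1 \<and> joins02 t2 \<and> joins12 t3) \<and>
    (joins12 t \<longleftrightarrow> joins12 t2 \<and> joins12 t3 \<or> joins01 t2 \<and> joins12 t1 \<and> joins02 t3) \<and>
    (joins01 t1 \<or> joins02 t1 \<and> joins01 t3 \<and> joins02 t2 \<or>
     joins01 t2 \<or> joins12 t2 \<and> joins01 t3 \<and> joins12 t1 \<or>
     joins02 t3 \<and> joins12 t1 \<or> joins12 t3 \<and> joins02 t2) \<and>
    (joins02 t1 \<or> joins01 t1 \<and> joins02 t2 \<and> joins01 t3 \<or>
     joins01 t2 \<and> joins12 t1 \<or> joins12 t2 \<and> joins01 t3 \<or>
     joins02 t3 \<or> joins12 t3 \<and> joins02 t2 \<and> joins12 t1) \<and>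
    (joins01 t1 \<and> joins02 t2 \<or> joins02 t1 \<and> joins01 t3 \<or>
     joins12 t2 \<or> joins01 t2 \<and> joins12 t1 \<and> joins01 t3 \<or>
     joins12 t3 \<or> joins02 t3 \<and> joins12 t1 \<and> joins02 t2)"

text \<open>Each of the three junctions merges at most one pair of blocks, and every resulting block
  reaches an outer corner. The proof checks all combinations of types.\<close>

lemma glues_blocks_le: "glues t t1 t2 t3 \<Longrightarrow> blocks t1 + blocks t2 + blocks t3 \<le> blocks t + 3"
proof -
  have "\<forall>t t1 t2 t3. glues t t1 t2 t3 \<longrightarrow> blocks t1 + blocks t2 + blocks t3 \<le> blocks t + 3"
    by (simp add: all_ctype glues_def)
  then show "glues t t1 t2 t3 \<Longrightarrow> blocks t1 + blocks t2 + blocks t3 \<le> blocks t + 3" by blast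
qed

definition glue_set :: "ctype \<Rightarrow> (ctype \<times> ctype \<times> ctype) set" where
  "glue_set t = {(t1, t2, t3). glues t t1 t2 t3 \<and> blocks t1 + blocks t2 + blocks t3 = blocks t + 3}"

text \<open>The copies have the corner triples \<open>(k, x, y)\<close>, \<open>(x, a, z)\<close>,
  \<open>(y, z, b)\<close>, each in the order leftmost, rightmost, topmost. Keeping this order lets
  translations carry types to types.\<close>

locale corner_gluing =
  fixes V1 V2 V3 :: "'v set" and E1 E2 E3 :: "'v set set" and k a b x y z :: 'v
  assumes graphs: "simple_graph V1 E1" "simple_graph V2 E2" "simple_graph V3 E3"
    and corners: "k \<in> V1" "a \<in> V2" "b \<in> V3"
    and inter: "V1 \<inter> V2 = {x}" "V1 \<inter> V3 = {y}" "V2 \<inter> V3 = {z}"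
    and dist: "distinct [k, a, b, x, y, z]"
begin

lemma mem: "x \<in> V1" "y \<in> V1" "x \<in> V2" "z \<in> V2" "y \<in> V3" "z \<in> V3"
  using inter by blast+

text \<open>The cyclic symmetry of the three copies, by which statements about paths starting at
  \<open>k\<close> also serve for \<open>a\<close> and \<open>b\<close>.\<close>

lemma rotate: "corner_gluing V2 V3 V1 E2 E3 E1 a b k z x y"
proof
  show "simple_graph V2 E2" "simple_graph V3 E3" "simple_graph V1 E1" by (fact graphs)+
  show "a \<in> V2" "b \<in> V3" "k \<in> V1" by (fact corners)+
  show "V2 \<inter> V3 = {z}" "V2 \<inter> V1 = {x}" "V3 \<inter> V1 = {y}" using inter by blast+
  show "distinct [a, b, k, z, x, y]" using dist by auto
qed

lemma edge_subset: "e \<in> E1 \<Longrightarrow> e \<subseteq> V1" "e \<in> E2 \<Longrightarrow> e \<subseteq> V2" "e \<in> E3 \<Longrightarrow> e \<subseteq> V3"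
proof -
  have "e \<subseteq> V" if "simple_graph V E" "e \<in> E" for V E and e :: "'v set"
    by (rule simple_graph_edgeE[OF that]) simp
  then show "e \<in> E1 \<Longrightarrow> e \<subseteq> V1" "e \<in> E2 \<Longrightarrow> e \<subseteq> V2" "e \<in> E3 \<Longrightarrow> e \<subseteq> V3"
    using graphs by blast+
qed

text \<open>An edge has two distinct ends, whereas two copies share a single vertex.\<close>

lemma edge_disjoint: "E1 \<inter> E2 = {}" "E1 \<inter> E3 = {}" "E2 \<inter> E3 = {}"
proof -
  have no_edge: "e \<notin> E1 \<union> E2" if "e \<subseteq> {v}" for e v
  proof
    assume "e \<in> E1 \<union> E2"
    then have "\<exists>u w. e = {u, w} \<and> u \<noteq> w"
      by (elim UnE) (metis simple_graph_edgeE graphs(1,2))+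
    then show False using that by auto
  qed
  have "e \<notin> E2" if "e \<in> E1" for e
    using no_edge[of e x] edge_subset(1,2)[of e] inter(1) that by blast
  moreover have "e \<notin> E3" if "e \<in> E1" for e
    using no_edge[of e y] edge_subset(1,3)[of e] inter(2) that by blast
  moreover have "e \<notin> E3" if "e \<in> E2" for e
    using no_edge[of e z] edge_subset(2,3)[of e] inter(3) that by blast
  ultimately show "E1 \<inter> E2 = {}" "E1 \<inter> E3 = {}" "E2 \<inter> E3 = {}" by blast+
qed

lemma card_verts: "card (V1 \<union> V2 \<union> V3) + 3 = card V1 + card V2 + card V3"
proof -
  have fin: "finite V1" "finite V2" "finite V3" using graphs simple_graph_finite by auto
  have "card (V1 \<union> V2) + 1 = card V1 + card V2"
    using card_Un_Int[OF fin(1,2)] inter by simp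
  moreover have "(V1 \<union> V2) \<inter> V3 = {y, z}" using inter by auto
  then have "card (V1 \<union> V2 \<union> V3) + 2 = card (V1 \<union> V2) + card V3"
    using card_Un_Int[of "V1 \<union> V2" V3] fin dist by simp
  ultimately show ?thesis by simp
qed

context
  fixes T1 T2 T3 T
  assumes sub: "T1 \<subseteq> E1" "T2 \<subseteq> E2" "T3 \<subseteq> E3" and T: "T = T1 \<union> T2 \<union> T3"
begin

lemma conn_parts: "(u, v) \<in> conn T1 \<Longrightarrow> (u, v) \<in> conn T" "(u, v) \<in> conn T2 \<Longrightarrow> (u, v) \<in> conn T"
  "(u, v) \<in> conn T3 \<Longrightarrow> (u, v) \<in> conn T"
  using conn_mono[of u v _ T] T by auto

text \<open>A path of the glued graph changes its copy only at corners of copies, so a set of corners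
  closed under the connections inside each copy controls everything reachable from it.\<close>

lemma conn_glued:
  assumes conn: "(u, w) \<in> conn T" and u: "u \<in> {k, a, b, x, y, z}" and Q: "Q u"
    and closed: "\<And>c d. Q c \<Longrightarrow> c \<in> {k, x, y} \<Longrightarrow> d \<in> {k, x, y} \<Longrightarrow> (c, d) \<in> conn T1 \<Longrightarrow> Q d"
    "\<And>c d. Q c \<Longrightarrow> c \<in> {x, a, z} \<Longrightarrow> d \<in> {x, a, z} \<Longrightarrow> (c, d) \<in> conn T2 \<Longrightarrow> Q d"
    "\<And>c d. Q c \<Longrightarrow> c \<in> {y, z, b} \<Longrightarrow> d \<in> {y, z, b} \<Longrightarrow> (c, d) \<in> conn T3 \<Longrightarrow> Q d"
  shows "(w \<in> V1 \<longrightarrow> (\<exists>c\<in>{k, x, y}. Q c \<and> (c, w) \<in> conn T1)) \<and>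
    (w \<in> V2 \<longrightarrow> (\<exists>c\<in>{x, a, z}. Q c \<and> (c, w) \<in> conn T2)) \<and>
    (w \<in> V3 \<longrightarrow> (\<exists>c\<in>{y, z, b}. Q c \<and> (c, w) \<in> conn T3))"
  using conn
proof (induction rule: conn_induct)
  case refl
  have mem_u: "u \<in> V1 \<Longrightarrow> u \<in> {k, x, y}" "u \<in> V2 \<Longrightarrow> u \<in> {x, a, z}" "u \<in> V3 \<Longrightarrow> u \<in> {y, z, b}"
    using u inter corners mem dist by auto
  have base: "\<exists>c\<in>A. Q c \<and> (c, u) \<in> conn S" if "u \<in> A" for A S
    using that Q by (intro bexI[of _ u]) auto
  show ?case by (intro conjI impI base mem_u)
next
  case (step s t)
  from step(2) T consider (1) "{s, t} \<in> T1" | (2) "{s, t} \<in> T2" | (3) "{s, t} \<in> T3" by blast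
  then show ?case
  proof cases
    case 1
    then have V: "s \<in> V1" "t \<in> V1" using edge_subset(1)[of "{s, t}"] sub by auto
    then obtain c where c: "c \<in> {k, x, y}" "Q c" "(c, s) \<in> conn T1" using step.IH by blast
    have ct: "(c, t) \<in> conn T1" using conn_trans[OF c(3) conn_edge[OF 1]] .
    have t: "t \<in> {k, x, y} \<Longrightarrow> Q t" using closed(1)[OF c(2,1) _ ct] by blast
    have "\<exists>c\<in>{k, x, y}. Q c \<and> (c, t) \<in> conn T1" using c(1,2) ct by blast
    moreover have "\<exists>c\<in>{x, a, z}. Q c \<and> (c, t) \<in> conn T2" if "t \<in> V2"
    proof -
      have "t = x" using V(2) that inter by blast
      then show ?thesis using t by (intro bexI[of _ x]) simp_all
    qed
    moreover have "\<exists>c\<in>{y, z, b}. Q c \<and> (c, t) \<in> conn T3" if "t \<in> V3"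
    proof -
      have "t = y" using V(2) that inter by blast
      then show ?thesis using t by (intro bexI[of _ y]) simp_all
    qed
    ultimately show ?thesis by simp
  next
    case 2
    then have V: "s \<in> V2" "t \<in> V2" using edge_subset(2)[of "{s, t}"] sub by auto
    then obtain c where c: "c \<in> {x, a, z}" "Q c" "(c, s) \<in> conn T2" using step.IH by blast
    have ct: "(c, t) \<in> conn T2" using conn_trans[OF c(3) conn_edge[OF 2]] .
    have t: "t \<in> {x, a, z} \<Longrightarrow> Q t" using closed(2)[OF c(2,1) _ ct] by blast
    have "\<exists>c\<in>{x, a, z}. Q c \<and> (c, t) \<in> conn T2" using c(1,2) ct by blast
    moreover have "\<exists>c\<in>{k, x, y}. Q c \<and> (c, t) \<in> conn T1" if "t \<in> V1"
    proof -
      have "t = x" using V(2) that inter by blast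
      then show ?thesis using t by (intro bexI[of _ x]) simp_all
    qed
    moreover have "\<exists>c\<in>{y, z, b}. Q c \<and> (c, t) \<in> conn T3" if "t \<in> V3"
    proof -
      have "t = z" using V(2) that inter by blast
      then show ?thesis using t by (intro bexI[of _ z]) simp_all
    qed
    ultimately show ?thesis by simp
  next
    case 3
    then have V: "s \<in> V3" "t \<in> V3" using edge_subset(3)[of "{s, t}"] sub by auto
    then obtain c where c: "c \<in> {y, z, b}" "Q c" "(c, s) \<in> conn T3" using step.IH by blast
    have ct: "(c, t) \<in> conn T3" using conn_trans[OF c(3) conn_edge[OF 3]] .
    have t: "t \<in> {y, z, b} \<Longrightarrow> Q t" using closed(3)[OF c(2,1) _ ct] by blast
    have "\<exists>c\<in>{y, z, b}. Q c \<and> (c, t) \<in> conn T3" using c(1,2) ct by blast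
    moreover have "\<exists>c\<in>{k, x, y}. Q c \<and> (c, t) \<in> conn T1" if "t \<in> V1"
    proof -
      have "t = y" using V(2) that inter by blast
      then show ?thesis using t by (intro bexI[of _ y]) simp_all
    qed
    moreover have "\<exists>c\<in>{x, a, z}. Q c \<and> (c, t) \<in> conn T2" if "t \<in> V2"
    proof -
      have "t = z" using V(2) that inter by blast
      then show ?thesis using t by (intro bexI[of _ z]) simp_all
    qed
    ultimately show ?thesis by simp
  qed
qed

text \<open>The copies form a ring with links \<open>x\<close>, \<open>z\<close>, \<open>y\<close>,
  so a connection from \<open>k\<close> has only two ways to go round: through \<open>x\<close>
  first or through \<open>y\<close> first.\<close>

lemma conn_from_corner:
  "(k, x) \<in> conn T \<longleftrightarrow> (k, x) \<in> conn T1 \<or> (k, y) \<in> conn T1 \<and> (y, z) \<in> conn T3 \<and> (x, z) \<in> conn T2"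
  "(k, y) \<in> conn T \<longleftrightarrow> (k, y) \<in> conn T1 \<or> (k, x) \<in> conn T1 \<and> (x, z) \<in> conn T2 \<and> (y, z) \<in> conn T3"
  "(k, z) \<in> conn T \<longleftrightarrow> (k, x) \<in> conn T1 \<and> (x, z) \<in> conn T2 \<or> (k, y) \<in> conn T1 \<and> (y, z) \<in> conn T3"
  "(k, a) \<in> conn T \<longleftrightarrow> (k, x) \<in> conn T1 \<and> (x, a) \<in> conn T2 \<or>
     (k, y) \<in> conn T1 \<and> (y, z) \<in> conn T3 \<and> (a, z) \<in> conn T2"
  "(k, b) \<in> conn T \<longleftrightarrow> (k, y) \<in> conn T1 \<and> (y, b) \<in> conn T3 \<or>
     (k, x) \<in> conn T1 \<and> (x, z) \<in> conn T2 \<and> (z, b) \<in> conn T3"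
proof -
  let ?x = "(k, x) \<in> conn T1 \<or> (k, y) \<in> conn T1 \<and> (y, z) \<in> conn T3 \<and> (x, z) \<in> conn T2"
  let ?y = "(k, y) \<in> conn T1 \<or> (k, x) \<in> conn T1 \<and> (x, z) \<in> conn T2 \<and> (y, z) \<in> conn T3"
  let ?z = "(k, x) \<in> conn T1 \<and> (x, z) \<in> conn T2 \<or> (k, y) \<in> conn T1 \<and> (y, z) \<in> conn T3"
  let ?a = "(k, x) \<in> conn T1 \<and> (x, a) \<in> conn T2 \<or>
     (k, y) \<in> conn T1 \<and> (y, z) \<in> conn T3 \<and> (a, z) \<in> conn T2"
  let ?b = "(k, y) \<in> conn T1 \<and> (y, b) \<in> conn T3 \<or>
     (k, x) \<in> conn T1 \<and> (x, z) \<in> conn T2 \<and> (z, b) \<in> conn T3"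
  \<comment> \<open>\<open>Q\<close> is the claimed set of corners reachable from \<open>k\<close>;
    the substance is that it is closed under the connections inside each copy.\<close>
  define Q where "Q w \<longleftrightarrow> w = k \<or> w = x \<and> ?x \<or> w = y \<and> ?y \<or> w = z \<and> ?z \<or> w = a \<and> ?a \<or> w = b \<and> ?b"
    for w
  have Q: "Q k" "Q x \<longleftrightarrow> ?x" "Q y \<longleftrightarrow> ?y" "Q z \<longleftrightarrow> ?z" "Q a \<longleftrightarrow> ?a" "Q b \<longleftrightarrow> ?b"
    using dist unfolding Q_def by auto
  \<comment> \<open>Expressing the connections inside a copy through its type builds in
    transitivity, so closedness becomes a finite check.\<close>
  obtain t1 where t1: "has_type T1 k x y t1" using has_type_ex[of T1 k x y] by blast
  obtain t2 where t2: "has_type T2 x a z t2" using has_type_ex[of T2 x a z] by blast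
  obtain t3 where t3: "has_type T3 y z b t3" using has_type_ex[of T3 y z b] by blast
  note types = t1[unfolded has_type_def] t2[unfolded has_type_def] t3[unfolded has_type_def]
  note rev = conn_commute[of x k] conn_commute[of y k] conn_commute[of y x T1]
    conn_commute[of a x] conn_commute[of z x] conn_commute[of z a]
    conn_commute[of z y] conn_commute[of b y] conn_commute[of b z]
  have c1: "Q d" if "Q c" "c \<in> {k, x, y}" "d \<in> {k, x, y}" "(c, d) \<in> conn T1" for c d
    using that unfolding insert_iff empty_iff
    by (elim disjE; cases t1; simp add: Q types rev)
  have c2: "Q d" if "Q c" "c \<in> {x, a, z}" "d \<in> {x, a, z}" "(c, d) \<in> conn T2" for c d
    using that unfolding insert_iff empty_iff
    by (elim disjE; cases t2; simp add: Q types rev)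
  have c3: "Q d" if "Q c" "c \<in> {y, z, b}" "d \<in> {y, z, b}" "(c, d) \<in> conn T3" for c d
    using that unfolding insert_iff empty_iff
    by (elim disjE; cases t3; auto simp: Q types rev)
  have reach: "Q w" if "(k, w) \<in> conn T" "w \<in> {x, y, z, a, b}" for w
  proof -
    have mem_w: "w \<in> V1 \<Longrightarrow> w \<in> {k, x, y}" "w \<in> V2 \<Longrightarrow> w \<in> {x, a, z}" "w \<in> V3 \<Longrightarrow> w \<in> {y, z, b}"
      using that(2) inter corners mem dist by auto
    have glued: "(w \<in> V1 \<longrightarrow> (\<exists>c\<in>{k, x, y}. Q c \<and> (c, w) \<in> conn T1)) \<and>
      (w \<in> V2 \<longrightarrow> (\<exists>c\<in>{x, a, z}. Q c \<and> (c, w) \<in> conn T2)) \<and>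
      (w \<in> V3 \<longrightarrow> (\<exists>c\<in>{y, z, b}. Q c \<and> (c, w) \<in> conn T3))"
      by (rule conn_glued[where Q = Q, OF that(1) _ Q(1) c1 c2 c3]) simp_all
    have "w \<in> V1 \<or> w \<in> V2 \<or> w \<in> V3" using that(2) corners mem by auto
    then show ?thesis
    proof (elim disjE)
      assume w: "w \<in> V1"
      then obtain c where "c \<in> {k, x, y}" "Q c" "(c, w) \<in> conn T1" using glued by blast
      then show ?thesis using c1[OF _ _ mem_w(1)[OF w]] by blast
    next
      assume w: "w \<in> V2"
      then obtain c where "c \<in> {x, a, z}" "Q c" "(c, w) \<in> conn T2" using glued by blast
      then show ?thesis using c2[OF _ _ mem_w(2)[OF w]] by blast
    next
      assume w: "w \<in> V3"
      then obtain c where "c \<in> {y, z, b}" "Q c" "(c, w) \<in> conn T3" using glued by blast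
      then show ?thesis using c3[OF _ _ mem_w(3)[OF w]] by blast
    qed
  qed
  note tr = conn_trans conn_trans[OF conn_trans]
  have to_x: "(k, x) \<in> conn T" if ?x
    using that by (auto intro: conn_parts tr(2)[OF conn_parts(1) conn_parts(3) conn_parts(2)] conn_sym)
  have to_y: "(k, y) \<in> conn T" if ?y
    using that by (auto intro: conn_parts tr(2)[OF conn_parts(1) conn_parts(2) conn_parts(3)] conn_sym)
  have to_z: "(k, z) \<in> conn T" if ?z
    using that by (auto intro: tr(1)[OF conn_parts(1) conn_parts(2)] tr(1)[OF conn_parts(1) conn_parts(3)])
  have to_a: "(k, a) \<in> conn T" if ?a
    using that by (auto intro: tr(1)[OF conn_parts(1) conn_parts(2)]
      tr(2)[OF conn_parts(1) conn_parts(3) conn_parts(2)] conn_sym)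
  have to_b: "(k, b) \<in> conn T" if ?b
    using that by (auto intro: tr(1)[OF conn_parts(1) conn_parts(3)]
      tr(2)[OF conn_parts(1) conn_parts(2) conn_parts(3)])
  show "(k, x) \<in> conn T \<longleftrightarrow> ?x" using to_x reach[of x] Q(2) by blast
  show "(k, y) \<in> conn T \<longleftrightarrow> ?y" using to_y reach[of y] Q(3) by blast
  show "(k, z) \<in> conn T \<longleftrightarrow> ?z" using to_z reach[of z] Q(4) by blast
  show "(k, a) \<in> conn T \<longleftrightarrow> ?a" using to_a reach[of a] Q(5) by blast
  show "(k, b) \<in> conn T \<longleftrightarrow> ?b" using to_b reach[of b] Q(6) by blast
qed

text \<open>A path entering a copy from outside passes through one of its corners, so each copy is
  covered by its own corners. Conversely, corners that are junctions must in turn be linked to an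
  outer corner, which is the extra condition.\<close>

lemma covers_glued:
  "covers (V1 \<union> V2 \<union> V3) T k a b \<longleftrightarrow>
    covers V1 T1 k x y \<and> covers V2 T2 x a z \<and> covers V3 T3 y z b \<and>
    (\<forall>v\<in>{x, y, z}. (k, v) \<in> conn T \<or> (a, v) \<in> conn T \<or> (b, v) \<in> conn T)"
    (is "_ \<longleftrightarrow> _ \<and> _ \<and> _ \<and> ?junctions")
proof
  assume cov: "covers (V1 \<union> V2 \<union> V3) T k a b"
  have "?junctions" using cov mem unfolding covers_def by auto
  \<comment> \<open>With the trivial \<open>Q\<close>, \<open>conn_glued\<close> says just that
    whatever an outer corner reaches is attached, inside its own copy, to a corner of that
    copy.\<close>
  have part: "(v \<in> V1 \<longrightarrow> (\<exists>c\<in>{k, x, y}. True \<and> (c, v) \<in> conn T1)) \<and>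
    (v \<in> V2 \<longrightarrow> (\<exists>c\<in>{x, a, z}. True \<and> (c, v) \<in> conn T2)) \<and>
    (v \<in> V3 \<longrightarrow> (\<exists>c\<in>{y, z, b}. True \<and> (c, v) \<in> conn T3))"
    if "v \<in> V1 \<union> V2 \<union> V3" for v
    using bspec[OF cov[unfolded covers_def] that]
    by (elim disjE) (erule conn_glued[where Q = "\<lambda>_. True"]; simp)+
  have "covers V1 T1 k x y"
    unfolding covers_def
  proof
    fix v assume "v \<in> V1"
    then show "(k, v) \<in> conn T1 \<or> (x, v) \<in> conn T1 \<or> (y, v) \<in> conn T1" using part[of v] by simp
  qed
  moreover have "covers V2 T2 x a z"
    unfolding covers_def
  proof
    fix v assume "v \<in> V2"
    then show "(x, v) \<in> conn T2 \<or> (a, v) \<in> conn T2 \<or> (z, v) \<in> conn T2" using part[of v] by simp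
  qed
  moreover have "covers V3 T3 y z b"
    unfolding covers_def
  proof
    fix v assume "v \<in> V3"
    then show "(y, v) \<in> conn T3 \<or> (z, v) \<in> conn T3 \<or> (b, v) \<in> conn T3" using part[of v] by simp
  qed
  ultimately show "covers V1 T1 k x y \<and> covers V2 T2 x a z \<and> covers V3 T3 y z b \<and> ?junctions"
    using \<open>?junctions\<close> by (intro conjI)
next
  assume r: "covers V1 T1 k x y \<and> covers V2 T2 x a z \<and> covers V3 T3 y z b \<and> ?junctions"
  have reached: "(k, v) \<in> conn T \<or> (a, v) \<in> conn T \<or> (b, v) \<in> conn T"
    if "c \<in> {k, a, b, x, y, z}" "(c, v) \<in> conn T" for c v
  proof -
    have "(k, c) \<in> conn T \<or> (a, c) \<in> conn T \<or> (b, c) \<in> conn T" using r that(1) by auto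
    then show ?thesis using conn_trans[OF _ that(2)] by blast
  qed
  show "covers (V1 \<union> V2 \<union> V3) T k a b"
    unfolding covers_def
  proof
    fix v assume "v \<in> V1 \<union> V2 \<union> V3"
    then consider "v \<in> V1" | "v \<in> V2" | "v \<in> V3" by blast
    then show "(k, v) \<in> conn T \<or> (a, v) \<in> conn T \<or> (b, v) \<in> conn T"
    proof cases
      case 1
      then have "(k, v) \<in> conn T1 \<or> (x, v) \<in> conn T1 \<or> (y, v) \<in> conn T1"
        using r by (simp add: covers_def)
      then show ?thesis by (elim disjE) (rule reached[rotated], erule conn_parts, simp)+
    next
      case 2
      then have "(x, v) \<in> conn T2 \<or> (a, v) \<in> conn T2 \<or> (z, v) \<in> conn T2"
        using r by (simp add: covers_def)
      then show ?thesis by (elim disjE) (rule reached[rotated], erule conn_parts, simp)+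
    next
      case 3
      then have "(y, v) \<in> conn T3 \<or> (z, v) \<in> conn T3 \<or> (b, v) \<in> conn T3"
        using r by (simp add: covers_def)
      then show ?thesis by (elim disjE) (rule reached[rotated], erule conn_parts, simp)+
    qed
  qed
qed

text \<open>All connections among outer corners and junctions are Boolean combinations of the joins
  inside the copies; once these are substituted, the claim is propositional.\<close>

lemma type_glued:
  assumes "has_type T1 k x y t1" "has_type T2 x a z t2" "has_type T3 y z b t3"
  shows "covers (V1 \<union> V2 \<union> V3) T k a b \<and> has_type T k a b t \<longleftrightarrow>
    covers V1 T1 k x y \<and> covers V2 T2 x a z \<and> covers V3 T3 y z b \<and> glues t t1 t2 t3"
proof -
  interpret R: corner_gluing V2 V3 V1 E2 E3 E1 a b k z x y by (rule rotate)
  interpret S: corner_gluing V3 V1 V2 E3 E1 E2 b k a y z x by (rule R.rotate)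
  have T': "T = T2 \<union> T3 \<union> T1" "T = T3 \<union> T1 \<union> T2" using T by auto
  note types = assms[unfolded has_type_def]
  note rev = conn_commute[of x k T1] conn_commute[of y k T1] conn_commute[of y x T1]
    conn_commute[of a x T2] conn_commute[of z x T2] conn_commute[of z a T2]
    conn_commute[of z y T3] conn_commute[of b y T3] conn_commute[of b z T3]
  note from_k = conn_from_corner[unfolded rev types[THEN conjunct1]
    types[THEN conjunct2, THEN conjunct1] types[THEN conjunct2, THEN conjunct2]]
  note from_a = R.conn_from_corner[OF sub(2,3,1) T'(1), unfolded rev types[THEN conjunct1]
    types[THEN conjunct2, THEN conjunct1] types[THEN conjunct2, THEN conjunct2]]
  note from_b = S.conn_from_corner[OF sub(3,1,2) T'(2), unfolded rev types[THEN conjunct1]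
    types[THEN conjunct2, THEN conjunct1] types[THEN conjunct2, THEN conjunct2]]
  show ?thesis
    \<comment> \<open>The pairs of outer corners left out of \<open>from_a\<close> and
      \<open>from_b\<close> are already treated from their other end.\<close>
    unfolding covers_glued ball_simps has_type_def glues_def from_k from_a(1-4) from_b(1-3)
    by argo
qed

lemma forests_glued:
  "T \<in> forests (V1 \<union> V2 \<union> V3) (E1 \<union> E2 \<union> E3) k a b t \<longleftrightarrow>
    (\<exists>(t1, t2, t3) \<in> glue_set t. T1 \<in> forests V1 E1 k x y t1 \<and> T2 \<in> forests V2 E2 x a z t2 \<and>
      T3 \<in> forests V3 E3 y z b t3)"
proof -
  obtain t1 where t1: "has_type T1 k x y t1" using has_type_ex[of T1 k x y] by blast
  obtain t2 where t2: "has_type T2 x a z t2" using has_type_ex[of T2 x a z] by blast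
  obtain t3 where t3: "has_type T3 y z b t3" using has_type_ex[of T3 y z b] by blast
  note glued = type_glued[OF t1 t2 t3, of t]
  have type_iff: "has_type T1 k x y s1 \<longleftrightarrow> s1 = t1" "has_type T2 x a z s2 \<longleftrightarrow> s2 = t2"
    "has_type T3 y z b s3 \<longleftrightarrow> s3 = t3" for s1 s2 s3
    by (metis t1 has_type_unique) (metis t2 has_type_unique, metis t3 has_type_unique)
  have sum_le: "card V1 \<le> card T1 + blocks t1" "card V2 \<le> card T2 + blocks t2" "card V3 \<le> card T3 + blocks t3"
    if "covers V1 T1 k x y" "covers V2 T2 x a z" "covers V3 T3 y z b"
    using card_le_covers[OF graphs(1) sub(1) _ t1] card_le_covers[OF graphs(2) sub(2) _ t2]
      card_le_covers[OF graphs(3) sub(3) _ t3] that by auto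
  have fin: "finite T1" "finite T2" "finite T3"
    using sub graphs simple_graph_finite finite_subset by metis+
  have "card T = card T1 + card T2 + card T3"
  proof -
    have "T1 \<inter> T2 = {}" "(T1 \<union> T2) \<inter> T3 = {}" using sub edge_disjoint by auto
    then show ?thesis using fin unfolding T by (simp add: card_Un_disjoint)
  qed
  \<comment> \<open>A squeeze: adding the bounds \<open>sum_le\<close> and using
    \<open>card_verts\<close>, \<open>glues_blocks_le\<close> and the count for \<open>T\<close>
    gives a chain that begins and ends with the same number. Hence all inequalities are equalities,
    that is, the count holds in every copy.\<close>
  then have "covers (V1 \<union> V2 \<union> V3) T k a b \<and> has_type T k a b t \<and>
      card T + blocks t = card (V1 \<union> V2 \<union> V3) \<longleftrightarrow>
    covers V1 T1 k x y \<and> covers V2 T2 x a z \<and> covers V3 T3 y z b \<and> glues t t1 t2 t3 \<and>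
      blocks t1 + blocks t2 + blocks t3 = blocks t + 3 \<and> card T1 + blocks t1 = card V1 \<and>
      card T2 + blocks t2 = card V2 \<and> card T3 + blocks t3 = card V3"
    using glued sum_le glues_blocks_le[of t t1 t2 t3] card_verts by linarith
  moreover have "T \<subseteq> E1 \<union> E2 \<union> E3" using sub T by auto
  ultimately show ?thesis
    unfolding forests_def glue_set_def using sub by (auto simp: type_iff)
qed

end

text \<open>Gluing is a bijection: the parts of a forest are recovered by intersecting with the
  disjoint edge sets, and they determine their types. General multiplicative weights allow one proof
  for plain counts and for degree polynomials.\<close>

lemma sum_forests_glued:
  fixes w w1 w2 w3 :: "'v set set \<Rightarrow> 'a :: comm_semiring_1"
  assumes w: "\<And>T1 T2 T3. T1 \<subseteq> E1 \<Longrightarrow> T2 \<subseteq> E2 \<Longrightarrow> T3 \<subseteq> E3 \<Longrightarrow> w (T1 \<union> T2 \<union> T3) = w1 T1 * w2 T2 * w3 T3"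
  shows "sum w (forests (V1 \<union> V2 \<union> V3) (E1 \<union> E2 \<union> E3) k a b t) =
    (\<Sum>(t1, t2, t3)\<in>glue_set t. sum w1 (forests V1 E1 k x y t1) * sum w2 (forests V2 E2 x a z t2) *
      sum w3 (forests V3 E3 y z b t3))"
proof -
  let ?F1 = "forests V1 E1 k x y" and ?F2 = "forests V2 E2 x a z" and ?F3 = "forests V3 E3 y z b"
  let ?F = "forests (V1 \<union> V2 \<union> V3) (E1 \<union> E2 \<union> E3) k a b t"
  define A where "A = (\<lambda>(t1, t2, t3). ?F1 t1 \<times> ?F2 t2 \<times> ?F3 t3)"
  define S where "S = Sigma (glue_set t) A"
  define g where "g = (\<lambda>(p :: ctype \<times> ctype \<times> ctype, T1, T2, T3). T1 \<union> T2 \<union> T3 :: 'v set set)"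
  have "finite (UNIV :: (ctype \<times> ctype \<times> ctype) set)"
    by (simp add: finite_prod finite_ctype)
  then have fin_glue: "finite (glue_set t)" by (rule finite_subset[OF subset_UNIV])
  have sub: "T \<in> ?F1 s \<Longrightarrow> T \<subseteq> E1" "T \<in> ?F2 s \<Longrightarrow> T \<subseteq> E2" "T \<in> ?F3 s \<Longrightarrow> T \<subseteq> E3" for T s
    unfolding forests_def by auto
  have "finite (Pow E1)" "finite (Pow E2)" "finite (Pow E3)"
    using graphs simple_graph_finite(2) finite_Pow_iff by auto
  moreover have "?F1 s \<subseteq> Pow E1" "?F2 s \<subseteq> Pow E2" "?F3 s \<subseteq> Pow E3" for s
    unfolding forests_def by auto
  ultimately have fin: "finite (?F1 s)" "finite (?F2 s)" "finite (?F3 s)" for s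
    by (metis finite_subset)+
  have parts: "(T1 \<union> T2 \<union> T3) \<inter> E1 = T1" "(T1 \<union> T2 \<union> T3) \<inter> E2 = T2" "(T1 \<union> T2 \<union> T3) \<inter> E3 = T3"
    if "T1 \<subseteq> E1" "T2 \<subseteq> E2" "T3 \<subseteq> E3" for T1 T2 T3
    using that edge_disjoint by blast+
  have "inj_on g S"
  proof (rule inj_onI)
    fix p q assume pq: "p \<in> S" "q \<in> S" "g p = g q"
    obtain t1 t2 t3 T1 T2 T3 where p: "p = ((t1, t2, t3), T1, T2, T3)" by (metis prod_cases3 surj_pair)
    obtain s1 s2 s3 S1 S2 S3 where q: "q = ((s1, s2, s3), S1, S2, S3)" by (metis prod_cases3 surj_pair)
    note a = pq(1)[unfolded p] and b = pq(2)[unfolded q] and eq = pq(3)[unfolded p q]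
    have aa: "T1 \<in> ?F1 t1" "T2 \<in> ?F2 t2" "T3 \<in> ?F3 t3" using a unfolding S_def A_def by auto
    have bb: "S1 \<in> ?F1 s1" "S2 \<in> ?F2 s2" "S3 \<in> ?F3 s3" using b unfolding S_def A_def by auto
    have "T1 \<union> T2 \<union> T3 = S1 \<union> S2 \<union> S3" using eq unfolding g_def by simp
    then have TS: "T1 = S1" "T2 = S2" "T3 = S3"
      using parts[OF sub(1)[OF aa(1)] sub(2)[OF aa(2)] sub(3)[OF aa(3)]]
        parts[OF sub(1)[OF bb(1)] sub(2)[OF bb(2)] sub(3)[OF bb(3)]] by metis+
    have "t1 = s1" "t2 = s2" "t3 = s3"
      using aa bb has_type_unique[of S1 k x y] has_type_unique[of S2 x a z] has_type_unique[of S3 y z b]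
      unfolding TS forests_def by simp_all
    then show "p = q" unfolding p q using TS by simp
  qed
  moreover have "g ` S = ?F"
  proof (intro set_eqI iffI)
    fix T assume "T \<in> g ` S"
    then obtain t1 t2 t3 T1 T2 T3 where p: "(t1, t2, t3) \<in> glue_set t" "T1 \<in> ?F1 t1" "T2 \<in> ?F2 t2"
      "T3 \<in> ?F3 t3" "T = T1 \<union> T2 \<union> T3" unfolding S_def A_def g_def by auto
    then show "T \<in> ?F"
      using forests_glued[OF sub(1)[OF p(2)] sub(2)[OF p(3)] sub(3)[OF p(4)] p(5)] by blast
  next
    fix T assume T: "T \<in> ?F"
    then have "T = T \<inter> E1 \<union> T \<inter> E2 \<union> T \<inter> E3" unfolding forests_def by auto
    then obtain t1 t2 t3 where p: "(t1, t2, t3) \<in> glue_set t" "T \<inter> E1 \<in> ?F1 t1" "T \<inter> E2 \<in> ?F2 t2"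
      "T \<inter> E3 \<in> ?F3 t3" and eq: "T = T \<inter> E1 \<union> T \<inter> E2 \<union> T \<inter> E3"
      using forests_glued[of "T \<inter> E1" "T \<inter> E2" "T \<inter> E3" T t] T by auto
    then have "((t1, t2, t3), T \<inter> E1, T \<inter> E2, T \<inter> E3) \<in> S" unfolding S_def A_def by simp
    moreover have "g ((t1, t2, t3), T \<inter> E1, T \<inter> E2, T \<inter> E3) = T" using eq unfolding g_def by simp
    ultimately show "T \<in> g ` S" by (metis imageI)
  qed
  ultimately have "sum w ?F = sum (w \<circ> g) S" using sum.reindex[of g S w] by simp
  also have "\<dots> = (\<Sum>p\<in>glue_set t. \<Sum>q\<in>A p. (w \<circ> g) (p, q))"
    unfolding S_def using fin_glue fin by (subst sum.Sigma) (auto simp: A_def split: prod.splits)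
  also have "\<dots> = (\<Sum>(t1, t2, t3)\<in>glue_set t. sum w1 (?F1 t1) * sum w2 (?F2 t2) * sum w3 (?F3 t3))"
  proof (rule sum.cong[OF refl], clarify)
    fix t1 t2 t3
    have "(\<Sum>q\<in>A (t1, t2, t3). (w \<circ> g) ((t1, t2, t3), q)) =
      (\<Sum>(T1, T2, T3)\<in>?F1 t1 \<times> ?F2 t2 \<times> ?F3 t3. w1 T1 * (w2 T2 * w3 T3))"
      unfolding A_def g_def using w sub by (intro sum.cong) (auto simp: mult.assoc)
    also have "\<dots> = sum w1 (?F1 t1) * sum w2 (?F2 t2) * sum w3 (?F3 t3)"
      by (simp add: sum.cartesian_product[symmetric] sum_distrib_left[symmetric]
          sum_distrib_right[symmetric] mult.assoc)
    finally show "(\<Sum>q\<in>A (t1, t2, t3). (w \<circ> g) ((t1, t2, t3), q)) =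
      sum w1 (?F1 t1) * sum w2 (?F2 t2) * sum w3 (?F3 t3)" .
  qed
  finally show ?thesis .
qed

end

section \<open>Forests of the gasket\<close>

lemma conn_image:
  assumes "inj h"
  shows "(h u, h v) \<in> conn ((`) h ` T) \<longleftrightarrow> (u, v) \<in> conn T"
proof
  \<comment> \<open>The endpoint is arbitrary because the induction must also find that every
    intermediate vertex of the walk is an image.\<close>
  have "\<exists>w. y = h w \<and> (u, w) \<in> conn T" if "(h u, y) \<in> conn ((`) h ` T)" for y
    using that
  proof (induction rule: conn_induct)
    case refl
    show ?case by (intro exI[of _ u]) simp
  next
    case (step s t)
    then obtain w where w: "s = h w" "(u, w) \<in> conn T" by blast
    obtain d where d: "d \<in> T" "{s, t} = h ` d" using step(2) by (rule imageE)
    have "t \<in> h ` d" unfolding d(2)[symmetric] by simp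
    then obtain t' where t': "t = h t'" by (rule imageE)
    have "h ` d = h ` {w, t'}" unfolding d(2)[symmetric] by (simp add: w t')
    then have "d = {w, t'}" using inj_image_eq_iff[OF assms] by metis
    then have "{w, t'} \<in> T" using d(1) by simp
    then have "(u, t') \<in> conn T" by (intro conn_trans[OF w(2)] conn_edge)
    then show ?case using t' by (intro exI[of _ t']) simp
  qed
  moreover assume "(h u, h v) \<in> conn ((`) h ` T)"
  ultimately obtain w where "h v = h w" "(u, w) \<in> conn T" by metis
  then show "(u, v) \<in> conn T" using assms by (simp add: inj_eq)
next
  assume "(u, v) \<in> conn T"
  then show "(h u, h v) \<in> conn ((`) h ` T)"
  proof (induction rule: conn_induct)
    case (step s t)
    have "{h s, h t} \<in> (`) h ` T" using imageI[OF step(2), of "(`) h"] by simp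
    then show ?case using step.IH conn_edge conn_trans by metis
  qed simp
qed

lemma forests_image:
  assumes h: "inj h"
  shows "forests (h ` V) ((`) h ` E) (h p) (h q) (h r) t = (`) ((`) h) ` forests V E p q r t"
proof -
  have inj: "inj ((`) h)" using h by (simp add: inj_on_def inj_image_eq_iff)
  have key: "(`) h ` T \<in> forests (h ` V) ((`) h ` E) (h p) (h q) (h r) t \<longleftrightarrow> T \<in> forests V E p q r t" for T
  proof -
    have "card ((`) h ` T) = card T" "card (h ` V) = card V"
      using card_image inj h inj_on_subset by (metis subset_UNIV)+
    moreover have "(`) h ` T \<subseteq> (`) h ` E \<longleftrightarrow> T \<subseteq> E" using inj by (simp add: inj_image_subset_iff)
    ultimately show ?thesis
      unfolding forests_def covers_def has_type_def by (simp add: conn_image[OF h])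
  qed
  show ?thesis
  proof (intro set_eqI iffI)
    fix S assume S: "S \<in> forests (h ` V) ((`) h ` E) (h p) (h q) (h r) t"
    then have "S \<subseteq> (`) h ` E" unfolding forests_def by simp
    then obtain T where T: "S = (`) h ` T" by (rule subset_imageE)
    then have "T \<in> forests V E p q r t" using S key by simp
    then show "S \<in> (`) ((`) h) ` forests V E p q r t" unfolding T by (rule imageI)
  next
    fix S assume "S \<in> (`) ((`) h) ` forests V E p q r t"
    then obtain T where "S = (`) h ` T" "T \<in> forests V E p q r t" by (rule imageE)
    then show "S \<in> forests (h ` V) ((`) h ` E) (h p) (h q) (h r) t" using key by simp
  qed
qed

lemma simple_graph_image:
  assumes g: "simple_graph V E" and h: "inj h"
  shows "simple_graph (h ` V) ((`) h ` E)"
  unfolding simple_graph_def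
proof (intro conjI ballI)
  show "finite (h ` V)" using simple_graph_finite[OF g] by simp
  fix e assume "e \<in> (`) h ` E"
  then obtain e' where e': "e' \<in> E" "e = h ` e'" by (auto elim: imageE)
  from g e'(1) show "\<exists>u w. e = {u, w} \<and> u \<noteq> w \<and> u \<in> h ` V \<and> w \<in> h ` V"
  proof (rule simple_graph_edgeE)
    fix u w assume "e' = {u, w}" "u \<noteq> w" "u \<in> V" "w \<in> V"
    then show ?thesis using e'(2) h by (intro exI[of _ "h u"] exI[of _ "h w"]) (simp add: inj_eq)
  qed
qed

lemma simple_graph_Un:
  assumes "simple_graph V E" "simple_graph V' E'"
  shows "simple_graph (V \<union> V') (E \<union> E')"
  unfolding simple_graph_def
proof (intro conjI ballI)
  show "finite (V \<union> V')" using assms simple_graph_finite(1) by auto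
  fix e assume "e \<in> E \<union> E'"
  then show "\<exists>u w. e = {u, w} \<and> u \<noteq> w \<and> u \<in> V \<union> V' \<and> w \<in> V \<union> V'"
  proof (elim UnE)
    assume "e \<in> E"
    from assms(1) this obtain u w where "e = {u, w}" "u \<noteq> w" "u \<in> V" "w \<in> V" by (rule simple_graph_edgeE)
    then show ?thesis by (intro exI[of _ u] exI[of _ w]) simp
  next
    assume "e \<in> E'"
    from assms(2) this obtain u w where "e = {u, w}" "u \<noteq> w" "u \<in> V'" "w \<in> V'" by (rule simple_graph_edgeE)
    then show ?thesis by (intro exI[of _ u] exI[of _ w]) simp
  qed
qed

section \<open>The gasket as three glued translates\<close>

lemma sg_simple_graph: "simple_graph (sg_verts n) (sg_edges n)"
proof (induction n)
  case 0
  show ?case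
    unfolding simple_graph_def
  proof (intro conjI ballI)
    fix e assume "e \<in> sg_edges 0"
    then consider "e = {(0, 0), (1, 0)}" | "e = {(0, 0), (0, 1)}" | "e = {(1, 0), (0, 1)}" by auto
    then show "\<exists>u w. e = {u, w} \<and> u \<noteq> w \<and> u \<in> sg_verts 0 \<and> w \<in> sg_verts 0"
    proof cases
      case 1
      then show ?thesis by (intro exI[of _ "(0, 0)"] exI[of _ "(1, 0)"]) simp
    next
      case 2
      then show ?thesis by (intro exI[of _ "(0, 0)"] exI[of _ "(0, 1)"]) simp
    next
      case 3
      then show ?thesis by (intro exI[of _ "(1, 0)"] exI[of _ "(0, 1)"]) simp
    qed
  qed simp
next
  case (Suc n)
  have "inj ((+) d)" for d :: vertex by simp
  then show ?case using Suc by (simp add: simple_graph_Un simple_graph_image)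
qed

abbreviation right_shift :: "nat \<Rightarrow> vertex \<Rightarrow> vertex" where
  "right_shift n \<equiv> (+) (2 ^ n, 0)"

abbreviation up_shift :: "nat \<Rightarrow> vertex \<Rightarrow> vertex" where
  "up_shift n \<equiv> (+) (0, 2 ^ n)"

lemma sg_corner_gluing:
  "corner_gluing (sg_verts n) (right_shift n ` sg_verts n) (up_shift n ` sg_verts n)
     (sg_edges n) ((`) (right_shift n) ` sg_edges n) ((`) (up_shift n) ` sg_edges n)
     (0, 0) (2 ^ Suc n, 0) (0, 2 ^ Suc n) (2 ^ n, 0) (0, 2 ^ n) (2 ^ n, 2 ^ n)"
proof
  show "simple_graph (sg_verts n) (sg_edges n)" by (rule sg_simple_graph)
  show "simple_graph (right_shift n ` sg_verts n) ((`) (right_shift n) ` sg_edges n)"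
    "simple_graph (up_shift n ` sg_verts n) ((`) (up_shift n) ` sg_edges n)"
    by (rule simple_graph_image[OF sg_simple_graph], simp)+
  show "(0, 0) \<in> sg_verts n" by (rule sg_corners)
  show "(2 ^ Suc n, 0) \<in> right_shift n ` sg_verts n"
    using imageI[OF sg_corners(2)[of n], of "right_shift n"] by (simp add: mult_2)
  show "(0, 2 ^ Suc n) \<in> up_shift n ` sg_verts n"
    using imageI[OF sg_corners(3)[of n], of "up_shift n"] by (simp add: mult_2)
  show "sg_verts n \<inter> right_shift n ` sg_verts n = {(2 ^ n, 0)}"
    "sg_verts n \<inter> up_shift n ` sg_verts n = {(0, 2 ^ n)}"
    "right_shift n ` sg_verts n \<inter> up_shift n ` sg_verts n = {(2 ^ n, 2 ^ n)}"
    using sg_gluing[of n] by (simp_all add: a_vertex_def b_vertex_def c_vertex_def)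
qed simp

definition sg_forests :: "nat \<Rightarrow> ctype \<Rightarrow> vertex set set set" where
  "sg_forests n t = forests (sg_verts n) (sg_edges n) (0, 0) (2 ^ n, 0) (0, 2 ^ n) t"

lemma sg_forests_subset: "T \<in> sg_forests n t \<Longrightarrow> T \<subseteq> sg_edges n"
  by (simp add: sg_forests_def forests_def)

lemma finite_sg_edges: "finite (sg_edges n)"
  using sg_simple_graph simple_graph_finite by blast

lemma finite_sg_forests: "finite (sg_forests n t)"
  by (rule finite_subset[of _ "Pow (sg_edges n)"]) (use sg_forests_subset finite_sg_edges in auto)

text \<open>Both sides mean connected with \<open>card V - 1\<close> edges: take
  \<open>(0, 0)\<close> as root in \<open>spanning_trees_iff\<close>, and note that
  \<open>blocks Joined = 1\<close>.\<close>

lemma spanning_trees_sg: "spanning_trees (sg_verts n) (sg_edges n) = sg_forests n Joined"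
proof (intro set_eqI iffI)
  fix T
  have iff: "T \<in> spanning_trees (sg_verts n) (sg_edges n) \<longleftrightarrow>
    T \<subseteq> sg_edges n \<and> (\<forall>v\<in>sg_verts n. (v, (0, 0)) \<in> conn T) \<and> card T + 1 = card (sg_verts n)"
    by (rule spanning_trees_iff) (use sg_simple_graph[of n] sg_corners finite_sg_edges in \<open>simp_all add: simple_graph_def\<close>)
  {
    assume "T \<in> spanning_trees (sg_verts n) (sg_edges n)"
    then have T: "T \<subseteq> sg_edges n" "\<And>v. v \<in> sg_verts n \<Longrightarrow> (v, (0, 0)) \<in> conn T"
      "card T + 1 = card (sg_verts n)" using iff by auto
    have r: "((0, 0), v) \<in> conn T" if "v \<in> sg_verts n" for v using T(2)[OF that] conn_sym by metis
    have "((2 ^ n, 0), (0, 2 ^ n)) \<in> conn T"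
      using conn_trans[OF T(2) r] sg_corners by blast
    then show "T \<in> sg_forests n Joined"
      unfolding sg_forests_def forests_def covers_def has_type_def using T r sg_corners by simp
  }
  {
    assume "T \<in> sg_forests n Joined"
    then have T: "T \<subseteq> sg_edges n" "\<And>v. v \<in> sg_verts n \<Longrightarrow>
        ((0, 0), v) \<in> conn T \<or> ((2 ^ n, 0), v) \<in> conn T \<or> ((0, 2 ^ n), v) \<in> conn T"
      "((0, 0), (2 ^ n, 0)) \<in> conn T" "((0, 0), (0, 2 ^ n)) \<in> conn T" "card T + 1 = card (sg_verts n)"
      unfolding sg_forests_def forests_def covers_def has_type_def by auto
    have "((0, 0), v) \<in> conn T" if "v \<in> sg_verts n" for v
      using T(2)[OF that] conn_trans[OF T(3), of v] conn_trans[OF T(4), of v] by blast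
    then have "(v, (0, 0)) \<in> conn T" if "v \<in> sg_verts n" for v using that conn_sym by metis
    then show "T \<in> spanning_trees (sg_verts n) (sg_edges n)" using iff T by blast
  }
qed

lemma sum_sg_forests_Suc:
  fixes w w1 w2 w3 :: "vertex set set \<Rightarrow> 'a :: comm_semiring_1"
  assumes w: "\<And>T1 T2 T3. T1 \<subseteq> sg_edges n \<Longrightarrow> T2 \<subseteq> sg_edges n \<Longrightarrow> T3 \<subseteq> sg_edges n \<Longrightarrow>
    w (T1 \<union> (`) (right_shift n) ` T2 \<union> (`) (up_shift n) ` T3) = w1 T1 * w2 T2 * w3 T3"
  shows "sum w (sg_forests (Suc n) t) =
    (\<Sum>(t1, t2, t3)\<in>glue_set t. sum w1 (sg_forests n t1) * sum w2 (sg_forests n t2) * sum w3 (sg_forests n t3))"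
proof -
  let ?r = "right_shift n" and ?u = "up_shift n"
  interpret corner_gluing "sg_verts n" "?r ` sg_verts n" "?u ` sg_verts n"
    "sg_edges n" "(`) ?r ` sg_edges n" "(`) ?u ` sg_edges n"
    "(0, 0)" "(2 ^ Suc n, 0)" "(0, 2 ^ Suc n)" "(2 ^ n, 0)" "(0, 2 ^ n)" "(2 ^ n, 2 ^ n)"
    by (rule sg_corner_gluing)
  have inj: "inj ((`) ((`) ((+) d)))" "inj ((`) ((+) d))" "inj ((+) d)" for d :: vertex
    by (simp_all add: inj_on_def inj_image_eq_iff)
  have inv: "inv ((`) ((`) ((+) d))) ((`) ((+) d) ` T) = T" for d :: vertex and T
    using inv_f_f[OF inj(1), of d T] by simp
  have shifted: "forests (?r ` sg_verts n) ((`) ?r ` sg_edges n) (2 ^ n, 0) (2 ^ Suc n, 0) (2 ^ n, 2 ^ n) s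
      = (`) ((`) ?r) ` sg_forests n s"
    "forests (?u ` sg_verts n) ((`) ?u ` sg_edges n) (0, 2 ^ n) (2 ^ n, 2 ^ n) (0, 2 ^ Suc n) s
      = (`) ((`) ?u) ` sg_forests n s" for s
    using forests_image[OF inj(3), of "(2 ^ n, 0)" "sg_verts n" "sg_edges n" "(0, 0)" "(2 ^ n, 0)" "(0, 2 ^ n)" s]
      forests_image[OF inj(3), of "(0, 2 ^ n)" "sg_verts n" "sg_edges n" "(0, 0)" "(2 ^ n, 0)" "(0, 2 ^ n)" s]
    by (simp_all add: sg_forests_def mult_2)
  have reindex: "sum (\<lambda>T. v (inv ((`) ((`) ((+) d))) T)) ((`) ((`) ((+) d)) ` F) = sum v F"
    for v :: "vertex set set \<Rightarrow> 'a" and d :: vertex and F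
    by (subst sum.reindex) (simp_all add: inv inj_on_subset[OF inj(1)])
  \<comment> \<open>\<open>sum_forests_glued\<close> needs weights on the edge sets of the shifted
    copies, so \<open>w2\<close> and \<open>w3\<close> are pulled back along the inverse
    translations; \<open>reindex\<close> removes these again.\<close>
  have "sum w (sg_forests (Suc n) t) =
    (\<Sum>(t1, t2, t3)\<in>glue_set t. sum w1 (forests (sg_verts n) (sg_edges n) (0, 0) (2 ^ n, 0) (0, 2 ^ n) t1) *
      sum (\<lambda>T. w2 (inv ((`) ((`) ?r)) T))
        (forests (?r ` sg_verts n) ((`) ?r ` sg_edges n) (2 ^ n, 0) (2 ^ Suc n, 0) (2 ^ n, 2 ^ n) t2) *
      sum (\<lambda>T. w3 (inv ((`) ((`) ?u)) T))
        (forests (?u ` sg_verts n) ((`) ?u ` sg_edges n) (0, 2 ^ n) (2 ^ n, 2 ^ n) (0, 2 ^ Suc n) t3))"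
    unfolding sg_forests_def sg_verts.simps sg_edges.simps
  proof (rule sum_forests_glued)
    fix T1 T2 T3 assume T: "T1 \<subseteq> sg_edges n" "T2 \<subseteq> (`) ?r ` sg_edges n" "T3 \<subseteq> (`) ?u ` sg_edges n"
    obtain S2 where S2: "S2 \<subseteq> sg_edges n" "T2 = (`) ?r ` S2" using T(2) by (rule subset_imageE)
    obtain S3 where S3: "S3 \<subseteq> sg_edges n" "T3 = (`) ?u ` S3" using T(3) by (rule subset_imageE)
    show "w (T1 \<union> T2 \<union> T3) = w1 T1 * w2 (inv ((`) ((`) ?r)) T2) * w3 (inv ((`) ((`) ?u)) T3)"
      unfolding S2 S3 inv by (rule w[OF T(1) S2(1) S3(1)])
  qed
  then show ?thesis unfolding shifted reindex sg_forests_def .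
qed

section \<open>Degree generating polynomials\<close>

definition degree_in :: "vertex set set \<Rightarrow> vertex \<Rightarrow> nat" where
  "degree_in T v = card {e \<in> T. v \<in> e}"

text \<open>The degree of \<open>v\<close> adds up over the copies, so as generating polynomials the
  degree counts simply multiply under gluing.\<close>

definition degree_poly :: "nat \<Rightarrow> vertex \<Rightarrow> ctype \<Rightarrow> real poly" where
  "degree_poly n v t = (\<Sum>T\<in>sg_forests n t. monom 1 (degree_in T v))"

lemma coeff_degree_poly:
  "coeff (degree_poly n v t) j = real (card {T \<in> sg_forests n t. degree_in T v = j})"
  using finite_sg_forests[of n t] by (simp add: degree_poly_def coeff_sum sum.If_cases Int_def)

lemma degree_poly_outside:
  assumes "v \<notin> sg_verts n"
  shows "degree_poly n v t = [:real (card (sg_forests n t)):]"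
proof -
  have "degree_in T v = 0" if "T \<in> sg_forests n t" for T
  proof -
    have "v \<notin> e" if "e \<in> T" for e
      using assms sg_edges_verts[of n] sg_forests_subset[OF \<open>T \<in> sg_forests n t\<close>] that by blast
    then have empty: "{e \<in> T. v \<in> e} = {}" by blast
    show ?thesis unfolding degree_in_def empty by simp
  qed
  then show ?thesis
    by (simp add: degree_poly_def monom_0 of_nat_poly)
qed

text \<open>The partner of \<open>v\<close> in a shifted copy is its preimage. If the copy does not
  contain \<open>v\<close>, any vertex outside the stage serves as a placeholder, having degree 0 in
  every forest. The lower-left copy is not shifted, so there \<open>v\<close> is its own partner in
  either case.\<close>

lemma degree_poly_Suc:
  assumes v2: "v = right_shift n v2 \<or> v \<notin> right_shift n ` sg_verts n \<and> v2 \<notin> sg_verts n"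
    and v3: "v = up_shift n v3 \<or> v \<notin> up_shift n ` sg_verts n \<and> v3 \<notin> sg_verts n"
  shows "degree_poly (Suc n) v t =
    (\<Sum>(t1, t2, t3)\<in>glue_set t. degree_poly n v t1 * degree_poly n v2 t2 * degree_poly n v3 t3)"
  unfolding degree_poly_def
proof (rule sum_sg_forests_Suc)
  fix T1 T2 T3 assume T: "T1 \<subseteq> sg_edges n" "T2 \<subseteq> sg_edges n" "T3 \<subseteq> sg_edges n"
  let ?r = "right_shift n" and ?u = "up_shift n"
  interpret corner_gluing "sg_verts n" "?r ` sg_verts n" "?u ` sg_verts n"
    "sg_edges n" "(`) ?r ` sg_edges n" "(`) ?u ` sg_edges n"
    "(0, 0)" "(2 ^ Suc n, 0)" "(0, 2 ^ Suc n)" "(2 ^ n, 0)" "(0, 2 ^ n)" "(2 ^ n, 2 ^ n)"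
    by (rule sg_corner_gluing)
  have fin: "finite T1" "finite T2" "finite T3" using T finite_sg_edges finite_subset by blast+
  have add: "degree_in (A \<union> B) v = degree_in A v + degree_in B v" if "finite A" "finite B" "A \<inter> B = {}" for A B
  proof -
    have "{e \<in> A \<union> B. v \<in> e} = {e \<in> A. v \<in> e} \<union> {e \<in> B. v \<in> e}" by blast
    moreover have "{e \<in> A. v \<in> e} \<inter> {e \<in> B. v \<in> e} = {}" using that by blast
    ultimately show ?thesis using that by (simp add: degree_in_def card_Un_disjoint)
  qed
  have shift: "degree_in ((`) ((+) d) ` S) v = degree_in S v'"
    if S: "S \<subseteq> sg_edges n" and v: "v = d + v' \<or> v \<notin> (+) d ` sg_verts n \<and> v' \<notin> sg_verts n" for d v' S
  proof -
    have mem: "v \<in> (+) d ` e \<longleftrightarrow> v' \<in> e" if "e \<in> S" for e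
    proof -
      have "e \<subseteq> sg_verts n" using that S sg_edges_verts[of n] by blast
      then show ?thesis using v by auto
    qed
    have "{e \<in> (`) ((+) d) ` S. v \<in> e} = (`) ((+) d) ` {e \<in> S. v' \<in> e}" using mem by blast
    moreover have "inj_on ((`) ((+) d)) {e \<in> S. v' \<in> e}" by (simp add: inj_on_def inj_image_eq_iff)
    ultimately show ?thesis by (simp add: degree_in_def card_image)
  qed
  have disj: "T1 \<inter> (`) ?r ` T2 = {}" "(T1 \<union> (`) ?r ` T2) \<inter> (`) ?u ` T3 = {}"
    using Int_mono[OF T(1) image_mono[OF T(2), of "(`) ?r"]] Int_mono[OF T(1) image_mono[OF T(3), of "(`) ?u"]]
      Int_mono[OF image_mono[OF T(2), of "(`) ?r"] image_mono[OF T(3), of "(`) ?u"]]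
    unfolding edge_disjoint Int_Un_distrib2 by simp_all
  have "degree_in (T1 \<union> (`) ?r ` T2 \<union> (`) ?u ` T3) v = degree_in T1 v + degree_in T2 v2 + degree_in T3 v3"
    using fin disj by (simp add: add shift[OF T(2) v2] shift[OF T(3) v3])
  then show "monom 1 (degree_in (T1 \<union> (`) ?r ` T2 \<union> (`) ?u ` T3) v) =
    monom 1 (degree_in T1 v) * monom 1 (degree_in T2 v2) * (monom 1 (degree_in T3 v3) :: real poly)"
    by (simp add: mult_monom)
qed

section \<open>Averaging over the types\<close>

text \<open>An electrical network with three corners is equivalent to a star with three equal resistances
  \<open>r\<close>, whose forests of the types with 1, 2, 3 blocks are in the proportion \<open>1 : r : 3 * r^2\<close>; the
  weights are these coefficients. For stage \<open>n\<close> of the gasket, \<open>r = 1/3 * (5/3)^n\<close>.\<close>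

primrec type_weight :: "ctype \<Rightarrow> real" where
  "type_weight Joined = 1" | "type_weight Apart0 = 1" | "type_weight Apart1 = 1"
| "type_weight Apart2 = 1" | "type_weight Discrete = 3"

primrec type_total :: "ctype \<Rightarrow> real" where
  "type_total Joined = 6" | "type_total Apart0 = 10" | "type_total Apart1 = 10"
| "type_total Apart2 = 10" | "type_total Discrete = 50"

lemma sum_ctype:
  fixes h :: "ctype \<Rightarrow> 'a :: comm_monoid_add"
  shows "(\<Sum>t\<in>UNIV. h t) = h Joined + (h Apart0 + (h Apart1 + (h Apart2 + h Discrete)))"
  by (simp add: UNIV_ctype)

lemma sum_glue_set_if:
  fixes h :: "ctype \<Rightarrow> ctype \<Rightarrow> ctype \<Rightarrow> 'a :: comm_monoid_add"
  shows "(\<Sum>(t1, t2, t3)\<in>glue_set t. h t1 t2 t3) = (\<Sum>t1\<in>UNIV. \<Sum>t2\<in>UNIV. \<Sum>t3\<in>UNIV.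
    if glues t t1 t2 t3 \<and> blocks t1 + blocks t2 + blocks t3 = blocks t + 3 then h t1 t2 t3 else 0)"
proof -
  let ?P = "\<lambda>(t1, t2, t3). glues t t1 t2 t3 \<and> blocks t1 + blocks t2 + blocks t3 = blocks t + 3"
  have "(\<Sum>(t1, t2, t3)\<in>glue_set t. h t1 t2 t3) =
    (\<Sum>p\<in>UNIV \<times> UNIV \<times> UNIV. if ?P p then (\<lambda>(t1, t2, t3). h t1 t2 t3) p else 0)"
    unfolding glue_set_def
    by (subst sum.inter_filter[symmetric]) (auto simp: finite_prod finite_ctype intro: sum.cong)
  also have "\<dots> = (\<Sum>t1\<in>UNIV. \<Sum>t2\<in>UNIV. \<Sum>t3\<in>UNIV.
    if glues t t1 t2 t3 \<and> blocks t1 + blocks t2 + blocks t3 = blocks t + 3 then h t1 t2 t3 else 0)"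
    unfolding sum.cartesian_product by (intro sum.cong refl) (simp add: case_prod_beta)
  finally show ?thesis .
qed

text \<open>Obtained by testing all 125 triples; 6, 8, 8, 8 and 26 of them survive. The totals 6, 10
  and 50 in \<open>type_total\<close> are the weighted sizes of these lists.\<close>

lemma sum_glue_set:
  fixes h :: "ctype \<Rightarrow> ctype \<Rightarrow> ctype \<Rightarrow> 'a :: comm_monoid_add"
  shows
    "(\<Sum>(t1, t2, t3)\<in>glue_set Joined. h t1 t2 t3) =
      h Joined Joined Apart0 + h Joined Joined Apart1 + h Joined Apart0 Joined +
      h Joined Apart2 Joined + h Apart1 Joined Joined + h Apart2 Joined Joined"
    "(\<Sum>(t1, t2, t3)\<in>glue_set Apart0. h t1 t2 t3) =
      h Joined Apart0 Apart0 + h Apart0 Joined Apart0 + h Apart0 Joined Apart1 +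
      h Apart0 Apart0 Joined + h Apart0 Apart2 Joined + h Apart1 Joined Apart0 +
      h Apart2 Apart0 Joined + h Discrete Joined Joined"
    "(\<Sum>(t1, t2, t3)\<in>glue_set Apart1. h t1 t2 t3) =
      h Joined Apart0 Apart1 + h Joined Apart1 Apart0 + h Joined Apart1 Apart1 +
      h Joined Discrete Joined + h Apart1 Joined Apart1 + h Apart1 Apart1 Joined +
      h Apart1 Apart2 Joined + h Apart2 Apart1 Joined"
    "(\<Sum>(t1, t2, t3)\<in>glue_set Apart2. h t1 t2 t3) =
      h Joined Joined Discrete + h Joined Apart0 Apart2 + h Joined Apart2 Apart0 +
      h Joined Apart2 Apart2 + h Apart1 Joined Apart2 + h Apart2 Joined Apart1 +
      h Apart2 Joined Apart2 + h Apart2 Apart2 Joined"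
    "(\<Sum>(t1, t2, t3)\<in>glue_set Discrete. h t1 t2 t3) =
      h Joined Apart0 Discrete + h Joined Apart1 Discrete + h Joined Discrete Apart0 +
      h Joined Discrete Apart2 + h Apart0 Joined Discrete + h Apart0 Apart0 Apart1 +
      h Apart0 Apart0 Apart2 + h Apart0 Apart1 Apart0 + h Apart0 Apart1 Apart1 +
      h Apart0 Apart2 Apart0 + h Apart0 Apart2 Apart2 + h Apart0 Discrete Joined +
      h Apart1 Joined Discrete + h Apart1 Apart1 Apart0 + h Apart1 Apart1 Apart2 +
      h Apart1 Apart2 Apart0 + h Apart1 Apart2 Apart2 + h Apart2 Apart0 Apart1 +
      h Apart2 Apart0 Apart2 + h Apart2 Apart1 Apart1 + h Apart2 Apart1 Apart2 +
      h Apart2 Discrete Joined + h Discrete Joined Apart1 + h Discrete Joined Apart2 +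
      h Discrete Apart1 Joined + h Discrete Apart2 Joined"
  by (simp_all add: sum_glue_set_if sum_ctype glues_def add.assoc)

text \<open>The expectation over the types that a uniformly random forest of type \<open>t\<close>
  induces in the three copies; by \<open>forest_count_ratio\<close> these probabilities are the same
  at every stage.\<close>

definition glue_avg :: "ctype \<Rightarrow> (ctype \<Rightarrow> ctype \<Rightarrow> ctype \<Rightarrow> real) \<Rightarrow> real" where
  "glue_avg t h = (\<Sum>(t1, t2, t3)\<in>glue_set t.
     type_weight t1 * type_weight t2 * type_weight t3 / type_total t * h t1 t2 t3)"

text \<open>The law of the type of the lower-left copy alone, one row of a stochastic matrix for
  each type of the whole. It governs a vertex that lies in no other copy.\<close>

lemma glue_avg_marginal1:
  "glue_avg Joined (\<lambda>s _ _. h s) = (4 * h Joined + h Apart1 + h Apart2) / 6"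
  "glue_avg Apart0 (\<lambda>s _ _. h s) = (h Joined + 4 * h Apart0 + h Apart1 + h Apart2 + 3 * h Discrete) / 10"
  "glue_avg Apart1 (\<lambda>s _ _. h s) = (6 * h Joined + 3 * h Apart1 + h Apart2) / 10"
  "glue_avg Apart2 (\<lambda>s _ _. h s) = (6 * h Joined + h Apart1 + 3 * h Apart2) / 10"
  "glue_avg Discrete (\<lambda>s _ _. h s) = (12 * h Joined + 12 * h Apart0 + 7 * h Apart1 + 7 * h Apart2 + 12 * h Discrete) / 50"
  unfolding glue_avg_def sum_glue_set type_weight.simps type_total.simps by simp_all

lemma glue_avg_marginal2:
  "glue_avg Joined (\<lambda>_ s _. h s) = (4 * h Joined + h Apart0 + h Apart2) / 6"
  "glue_avg Apart0 (\<lambda>_ s _. h s) = (6 * h Joined + 3 * h Apart0 + h Apart2) / 10"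
  "glue_avg Apart1 (\<lambda>_ s _. h s) = (h Joined + h Apart0 + 4 * h Apart1 + h Apart2 + 3 * h Discrete) / 10"
  "glue_avg Apart2 (\<lambda>_ s _. h s) = (6 * h Joined + h Apart0 + 3 * h Apart2) / 10"
  "glue_avg Discrete (\<lambda>_ s _. h s) = (12 * h Joined + 7 * h Apart0 + 12 * h Apart1 + 7 * h Apart2 + 12 * h Discrete) / 50"
  unfolding glue_avg_def sum_glue_set type_weight.simps type_total.simps by simp_all

lemma glue_avg_marginal3:
  "glue_avg Joined (\<lambda>_ _ s. h s) = (4 * h Joined + h Apart0 + h Apart1) / 6"
  "glue_avg Apart0 (\<lambda>_ _ s. h s) = (6 * h Joined + 3 * h Apart0 + h Apart1) / 10"
  "glue_avg Apart1 (\<lambda>_ _ s. h s) = (6 * h Joined + h Apart0 + 3 * h Apart1) / 10"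
  "glue_avg Apart2 (\<lambda>_ _ s. h s) = (h Joined + h Apart0 + h Apart1 + 4 * h Apart2 + 3 * h Discrete) / 10"
  "glue_avg Discrete (\<lambda>_ _ s. h s) = (12 * h Joined + 7 * h Apart0 + 7 * h Apart1 + 12 * h Apart2 + 12 * h Discrete) / 50"
  unfolding glue_avg_def sum_glue_set type_weight.simps type_total.simps by simp_all

lemma sum_type_weights:
  "(\<Sum>(t1, t2, t3)\<in>glue_set t. type_weight t1 * type_weight t2 * type_weight t3) = type_total t"
  by (cases t; simp only: sum_glue_set type_weight.simps type_total.simps; simp)

lemma type_weight_pos: "type_weight t > 0" "type_total t > 0"
  by (cases t; simp)+

lemma glue_avg_const: "glue_avg t (\<lambda>_ _ _. c) = c"
proof -
  have "glue_avg t (\<lambda>_ _ _. c) =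
    (\<Sum>(t1, t2, t3)\<in>glue_set t. type_weight t1 * type_weight t2 * type_weight t3) * (c / type_total t)"
    unfolding glue_avg_def sum_distrib_right by (rule sum.cong) auto
  then show ?thesis using type_weight_pos(2)[of t] by (simp add: sum_type_weights)
qed

lemma glue_avg_mono:
  assumes "\<And>t1 t2 t3. h t1 t2 t3 \<le> h' t1 t2 t3"
  shows "glue_avg t h \<le> glue_avg t h'"
  unfolding glue_avg_def
proof (rule sum_mono, clarify)
  fix t1 t2 t3
  have "0 \<le> type_weight t1 * type_weight t2 * type_weight t3 / type_total t"
    using type_weight_pos less_imp_le by (intro divide_nonneg_nonneg mult_nonneg_nonneg) blast+
  then show "type_weight t1 * type_weight t2 * type_weight t3 / type_total t * h t1 t2 t3
      \<le> type_weight t1 * type_weight t2 * type_weight t3 / type_total t * h' t1 t2 t3"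
    by (rule mult_left_mono[OF assms])
qed

lemma glue_avg_bounds:
  assumes "\<And>t1 t2 t3. \<bar>h t1 t2 t3 - c\<bar> \<le> e"
  shows "\<bar>glue_avg t h - c\<bar> \<le> e"
proof -
  have "c - e \<le> h t1 t2 t3" "h t1 t2 t3 \<le> c + e" for t1 t2 t3 using assms[of t1 t2 t3] by linarith+
  then have "c - e \<le> glue_avg t h" "glue_avg t h \<le> c + e"
    using glue_avg_mono[of "\<lambda>_ _ _. c - e" h t] glue_avg_mono[of h "\<lambda>_ _ _. c + e" t]
    by (simp_all add: glue_avg_const)
  then show ?thesis by linarith
qed

text \<open>In every row of the three marginals \<open>Joined\<close> has weight at least 1/10, with
  equality when the outer corner of that copy is the one apart. The remaining 9/10 averages values
  in the interval, and the common term \<open>h Joined / 10\<close> cancels from its new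
  length.\<close>

lemma glue_avg_contracts:
  assumes h: "\<And>s. l \<le> h s \<and> h s \<le> u"
  shows "h Joined / 10 + 9 / 10 * l \<le> glue_avg t (\<lambda>s _ _. h s) \<and>
      glue_avg t (\<lambda>s _ _. h s) \<le> h Joined / 10 + 9 / 10 * u"
    and "h Joined / 10 + 9 / 10 * l \<le> glue_avg t (\<lambda>_ s _. h s) \<and>
      glue_avg t (\<lambda>_ s _. h s) \<le> h Joined / 10 + 9 / 10 * u"
    and "h Joined / 10 + 9 / 10 * l \<le> glue_avg t (\<lambda>_ _ s. h s) \<and>
      glue_avg t (\<lambda>_ _ s. h s) \<le> h Joined / 10 + 9 / 10 * u"
  using h[of Joined] h[of Apart0] h[of Apart1] h[of Apart2] h[of Discrete]
  by (cases t; simp add: glue_avg_marginal1 glue_avg_marginal2 glue_avg_marginal3; linarith)+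

text \<open>All values at step \<open>n\<close> lie in an interval of length
  \<open>(9 / 10) ^ n\<close>. The conserved \<open>L\<close> is a convex combination of three of
  them, hence in the same interval.\<close>

lemma averaging_converges:
  fixes D :: "nat \<Rightarrow> ctype \<Rightarrow> real"
  assumes step: "\<And>n l u t. (\<And>s. l \<le> D n s \<and> D n s \<le> u) \<Longrightarrow>
      D n Joined / 10 + 9 / 10 * l \<le> D (Suc n) t \<and> D (Suc n) t \<le> D n Joined / 10 + 9 / 10 * u"
    and init: "\<And>s. 0 \<le> D 0 s \<and> D 0 s \<le> 1"
    and inv: "\<And>n. 9 / 14 * D n Joined + 5 / 28 * D n p + 5 / 28 * D n q = L"
  shows "\<bar>D n t - L\<bar> \<le> (9 / 10) ^ n"
proof -
  have "\<exists>l u. u - l = (9 / 10) ^ n \<and> (\<forall>s. l \<le> D n s \<and> D n s \<le> u)"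
  proof (induction n)
    case 0
    show ?case using init by (intro exI[of _ 0] exI[of _ 1]) simp
  next
    case (Suc n)
    then obtain l u where lu: "u - l = (9 / 10) ^ n" "\<And>s. l \<le> D n s \<and> D n s \<le> u" by blast
    show ?case
    proof (intro exI conjI allI)
      show "(D n Joined / 10 + 9 / 10 * u) - (D n Joined / 10 + 9 / 10 * l) = (9 / 10) ^ Suc n"
        using lu(1) by (simp add: algebra_simps)
    qed (use step[OF lu(2)] in auto)
  qed
  then obtain l u where lu: "u - l = (9 / 10) ^ n" "\<And>s. l \<le> D n s \<and> D n s \<le> u" by blast
  have "l \<le> L" "L \<le> u" using inv[of n] lu(2)[of Joined] lu(2)[of p] lu(2)[of q] by linarith+
  then show ?thesis using lu(1) lu(2)[of t] by linarith
qed

section \<open>Forest counts and their fixed shape\<close>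

definition forest_count :: "nat \<Rightarrow> ctype \<Rightarrow> real" where
  "forest_count n t = real (card (sg_forests n t))"

lemma forest_count_Suc:
  "forest_count (Suc n) t =
    (\<Sum>(t1, t2, t3)\<in>glue_set t. forest_count n t1 * forest_count n t2 * forest_count n t3)"
proof -
  have "sum (\<lambda>_. 1) (sg_forests (Suc n) t) = (\<Sum>(t1, t2, t3)\<in>glue_set t.
    sum (\<lambda>_. 1) (sg_forests n t1) * sum (\<lambda>_. 1) (sg_forests n t2) * (sum (\<lambda>_. 1) (sg_forests n t3) :: real))"
    by (rule sum_sg_forests_Suc) simp
  then show ?thesis by (simp add: forest_count_def)
qed

lemma conn_triangle:
  assumes "T \<subseteq> {{p, q}, {p, r}, {q, r}}" "distinct [p, q, r]"
  shows "(p, q) \<in> conn T \<longleftrightarrow> {p, q} \<in> T \<or> {p, r} \<in> T \<and> {q, r} \<in> T"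
proof
  assume "{p, q} \<in> T \<or> {p, r} \<in> T \<and> {q, r} \<in> T"
  then show "(p, q) \<in> conn T"
    using conn_trans[OF conn_edge[of p r T] conn_sym[OF conn_edge[of q r T]]] conn_edge[of p q T] by blast
next
  assume conn: "(p, q) \<in> conn T"
  show "{p, q} \<in> T \<or> {p, r} \<in> T \<and> {q, r} \<in> T"
  proof (rule ccontr)
    assume "\<not> ({p, q} \<in> T \<or> {p, r} \<in> T \<and> {q, r} \<in> T)"
    \<comment> \<open>At most one edge remains, so \<open>q\<close> or \<open>p\<close> is isolated,
      and a singleton is closed under connections.\<close>
    then have T: "T \<subseteq> {{p, r}} \<or> T \<subseteq> {{q, r}}" using assms(1) by blast
    then show False
    proof
      assume "T \<subseteq> {{p, r}}"
      then have "t \<in> {q}" if "{s, t} \<in> T" "s \<in> {q}" for s t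
        using that assms(2) by (auto simp: doubleton_eq_iff)
      then have "p \<in> {q}" using conn_closed[OF conn_sym[OF conn], of "{q}"] by blast
      then show False using assms(2) by simp
    next
      assume "T \<subseteq> {{q, r}}"
      then have "t \<in> {p}" if "{s, t} \<in> T" "s \<in> {p}" for s t
        using that assms(2) by (auto simp: doubleton_eq_iff)
      then have "q \<in> {p}" using conn_closed[OF conn, of "{p}"] by blast
      then show False using assms(2) by simp
    qed
  qed
qed

lemma forests_triangle:
  fixes p q r :: 'v
  assumes d: "distinct [p, q, r]"
  defines "F \<equiv> forests {p, q, r} {{p, q}, {p, r}, {q, r}} p q r"
  shows "F Joined = {{{p, q}, {p, r}}, {{p, q}, {q, r}}, {{p, r}, {q, r}}}"
    and "F Apart0 = {{{q, r}}}" "F Apart1 = {{{p, r}}}" "F Apart2 = {{{p, q}}}" "F Discrete = {{}}"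
proof -
  define e1 e2 e3 where e: "e1 = {p, q}" "e2 = {p, r}" "e3 = {q, r}"
  have ne: "e1 \<noteq> e2" "e1 \<noteq> e3" "e2 \<noteq> e3" "e2 \<noteq> e1" "e3 \<noteq> e1" "e3 \<noteq> e2"
    using d unfolding e by (auto simp: doubleton_eq_iff)
  have iff: "T \<in> F t \<longleftrightarrow> T \<in> Pow {e1, e2, e3} \<and> (joins01 t \<longleftrightarrow> e1 \<in> T \<or> e2 \<in> T \<and> e3 \<in> T) \<and>
    (joins02 t \<longleftrightarrow> e2 \<in> T \<or> e1 \<in> T \<and> e3 \<in> T) \<and> (joins12 t \<longleftrightarrow> e3 \<in> T \<or> e1 \<in> T \<and> e2 \<in> T) \<and>
    card T + blocks t = 3" for T t
  proof (cases "T \<subseteq> {e1, e2, e3}")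
    case True
    then have sub: "T \<subseteq> {{p, q}, {p, r}, {q, r}}" "T \<subseteq> {{p, r}, {p, q}, {r, q}}"
      "T \<subseteq> {{q, r}, {q, p}, {r, p}}"
      unfolding e by (auto simp: insert_commute)
    have "(p, q) \<in> conn T \<longleftrightarrow> e1 \<in> T \<or> e2 \<in> T \<and> e3 \<in> T"
      using conn_triangle[OF sub(1)] d unfolding e by simp
    moreover have "(p, r) \<in> conn T \<longleftrightarrow> e2 \<in> T \<or> e1 \<in> T \<and> e3 \<in> T"
      using conn_triangle[OF sub(2)] d unfolding e by (auto simp: insert_commute)
    moreover have "(q, r) \<in> conn T \<longleftrightarrow> e3 \<in> T \<or> e1 \<in> T \<and> e2 \<in> T"
      using conn_triangle[OF sub(3)] d unfolding e by (auto simp: insert_commute)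
    moreover have "card {p, q, r} = 3" using d by simp
    moreover have "covers {p, q, r} T p q r" by (simp add: covers_def)
    ultimately show ?thesis
      using True unfolding F_def forests_def has_type_def e[symmetric] by auto
  next
    case False
    then show ?thesis unfolding F_def forests_def e[symmetric] by auto
  qed
  have pow: "Pow {e1, e2, e3} = {{}, {e1}, {e2}, {e3}, {e1, e2}, {e1, e3}, {e2, e3}, {e1, e2, e3}}"
    by (auto simp: Pow_insert)
  have F: "F t = {T \<in> Pow {e1, e2, e3}. (joins01 t \<longleftrightarrow> e1 \<in> T \<or> e2 \<in> T \<and> e3 \<in> T) \<and>
    (joins02 t \<longleftrightarrow> e2 \<in> T \<or> e1 \<in> T \<and> e3 \<in> T) \<and> (joins12 t \<longleftrightarrow> e3 \<in> T \<or> e1 \<in> T \<and> e2 \<in> T) \<and>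
    card T + blocks t = 3}" for t
    by (rule set_eqI) (simp only: iff mem_Collect_eq)
  have filter: "{T \<in> insert a B. P T} = (if P a then insert a {T \<in> B. P T} else {T \<in> B. P T})"
    "{T \<in> {}. P T} = {}" for a B and P :: "'v set set \<Rightarrow> bool"
    by auto
  show "F Joined = {{{p, q}, {p, r}}, {{p, q}, {q, r}}, {{p, r}, {q, r}}}"
    unfolding F pow filter e[symmetric] using ne by simp
  show "F Apart0 = {{{q, r}}}" "F Apart1 = {{{p, r}}}" "F Apart2 = {{{p, q}}}" "F Discrete = {{}}"
    unfolding F pow filter e[symmetric] using ne by simp_all
qed

lemma sg_forests_0:
  "sg_forests 0 Joined = {{{(0, 0), (1, 0)}, {(0, 0), (0, 1)}}, {{(0, 0), (1, 0)}, {(1, 0), (0, 1)}},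
     {{(0, 0), (0, 1)}, {(1, 0), (0, 1)}}}"
  "sg_forests 0 Apart0 = {{{(1, 0), (0, 1)}}}"
  "sg_forests 0 Apart1 = {{{(0, 0), (0, 1)}}}"
  "sg_forests 0 Apart2 = {{{(0, 0), (1, 0)}}}"
  "sg_forests 0 Discrete = {{}}"
  unfolding sg_forests_def sg_verts.simps sg_edges.simps power_0
  by - (rule forests_triangle, simp)+

lemma forest_count_0:
  "forest_count 0 Joined = 3" "forest_count 0 Apart0 = 1" "forest_count 0 Apart1 = 1"
  "forest_count 0 Apart2 = 1" "forest_count 0 Discrete = 1"
  by (simp_all add: forest_count_def sg_forests_0 doubleton_eq_iff)

text \<open>The triangle fits the star shape with \<open>r = 1/3\<close>. Gluing turns the
  coefficients 1, 1, 3 into 6, 10, 50, and 10/6 = 5/3 together with 50/6 = 3 * (5/3)^2 is again the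
  star shape, with \<open>r\<close> replaced by \<open>5/3 * r\<close>.\<close>

lemma forest_count_eq:
  "forest_count n Joined > 0 \<and>
    (\<forall>t. forest_count n t = forest_count n Joined * type_weight t * (1 / 3 * (5 / 3) ^ n) ^ (blocks t - 1))"
proof (induction n)
  case 0
  show ?case by (simp add: all_ctype forest_count_0 power2_eq_square numeral_2_eq_2)
next
  case (Suc n)
  define f r where "f = forest_count n Joined" and "r = 1 / 3 * (5 / 3 :: real) ^ n"
  have f: "f > 0" and r: "r > 0" and eq: "forest_count n t = f * type_weight t * r ^ (blocks t - 1)" for t
    using Suc unfolding f_def r_def by (blast, simp, blast)
  have r': "1 / 3 * (5 / 3 :: real) ^ Suc n = 5 / 3 * r" by (simp add: r_def)
  have counts: "forest_count n Joined = f" "forest_count n Apart0 = f * r" "forest_count n Apart1 = f * r"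
    "forest_count n Apart2 = f * r" "forest_count n Discrete = 3 * f * r * r"
    unfolding eq by (simp_all add: power2_eq_square)
  have "forest_count (Suc n) Joined = 6 * f ^ 3 * r"
    "forest_count (Suc n) Apart0 = 10 * f ^ 3 * r ^ 2" "forest_count (Suc n) Apart1 = 10 * f ^ 3 * r ^ 2"
    "forest_count (Suc n) Apart2 = 10 * f ^ 3 * r ^ 2" "forest_count (Suc n) Discrete = 50 * f ^ 3 * r ^ 3"
    unfolding forest_count_Suc sum_glue_set counts by (simp_all add: power2_eq_square power3_eq_cube)
  then show ?case
    using f r unfolding r' by (simp add: all_ctype power2_eq_square power3_eq_cube)
qed

lemma forest_count_pos: "forest_count n t > 0"
proof -
  have "0 < forest_count n Joined * type_weight t * (1 / 3 * (5 / 3) ^ n) ^ (blocks t - 1)"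
    using forest_count_eq[THEN conjunct1, of n] type_weight_pos(1)[of t] by simp
  then show ?thesis using forest_count_eq[of n] by metis
qed

text \<open>Each copy contributes \<open>r\<close> to the power of its blocks minus one. For every
  triple in \<open>glue_set t\<close> the exponents add up to \<open>blocks t\<close>, so all powers
  of \<open>r\<close> are the same and cancel.\<close>

lemma forest_count_ratio:
  assumes "(t1, t2, t3) \<in> glue_set t"
  shows "forest_count n t1 * forest_count n t2 * forest_count n t3 / forest_count (Suc n) t =
    type_weight t1 * type_weight t2 * type_weight t3 / type_total t"
proof -
  define f r where "f = forest_count n Joined" and "r = 1 / 3 * (5 / 3 :: real) ^ n"
  have prod: "forest_count n s1 * forest_count n s2 * forest_count n s3 =
    (f ^ 3 * r ^ blocks t) * (type_weight s1 * type_weight s2 * type_weight s3)"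
    if "(s1, s2, s3) \<in> glue_set t" for s1 s2 s3
  proof -
    have "1 \<le> blocks s" for s by (cases s) simp_all
    then have "blocks s1 - 1 + (blocks s2 - 1) + (blocks s3 - 1) = blocks t"
      using that le_add_diff_inverse[of 1 "blocks s1"] le_add_diff_inverse[of 1 "blocks s2"]
        le_add_diff_inverse[of 1 "blocks s3"] unfolding glue_set_def by force
    then have "r ^ blocks t = r ^ (blocks s1 - 1) * r ^ (blocks s2 - 1) * r ^ (blocks s3 - 1)"
      by (metis power_add)
    moreover have eq: "forest_count n s = f * type_weight s * r ^ (blocks s - 1)" for s
      using forest_count_eq[of n] unfolding f_def r_def by blast
    ultimately show ?thesis unfolding eq by (simp add: power3_eq_cube algebra_simps)
  qed
  have "forest_count (Suc n) t = (\<Sum>(s1, s2, s3)\<in>glue_set t.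
    (f ^ 3 * r ^ blocks t) * (type_weight s1 * type_weight s2 * type_weight s3))"
    unfolding forest_count_Suc using prod by (intro sum.cong) auto
  also have "\<dots> = (f ^ 3 * r ^ blocks t) *
    (\<Sum>(s1, s2, s3)\<in>glue_set t. type_weight s1 * type_weight s2 * type_weight s3)"
    unfolding sum_distrib_left by (rule sum.cong) auto
  finally have eq: "forest_count (Suc n) t = (f ^ 3 * r ^ blocks t) * type_total t"
    unfolding sum_type_weights .
  have "f ^ 3 * r ^ blocks t \<noteq> 0"
    using forest_count_pos[of n Joined] unfolding f_def r_def by simp
  then show ?thesis unfolding prod[OF assms] eq by (rule mult_divide_mult_cancel_left)
qed

text \<open>The probability generating polynomial of the degree of \<open>v\<close> in a uniformly
  random forest of type \<open>t\<close>.\<close>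

definition type_poly :: "nat \<Rightarrow> vertex \<Rightarrow> ctype \<Rightarrow> real poly" where
  "type_poly n v t = smult (1 / forest_count n t) (degree_poly n v t)"

lemma type_poly_outside: "v \<notin> sg_verts n \<Longrightarrow> type_poly n v t = 1"
  using forest_count_pos[of n t] by (simp add: type_poly_def degree_poly_outside forest_count_def one_pCons)

lemma coeff_type_poly_bounds: "0 \<le> coeff (type_poly n v t) j" "coeff (type_poly n v t) j \<le> 1"
proof -
  have "card {T \<in> sg_forests n t. degree_in T v = j} \<le> card (sg_forests n t)"
    by (rule card_mono[OF finite_sg_forests]) auto
  then show "0 \<le> coeff (type_poly n v t) j" "coeff (type_poly n v t) j \<le> 1"
    using forest_count_pos[of n t]
    by (simp_all add: type_poly_def coeff_degree_poly forest_count_def divide_le_eq)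
qed

lemma coeff_type_poly_Suc:
  assumes "v = right_shift n v2 \<or> v \<notin> right_shift n ` sg_verts n \<and> v2 \<notin> sg_verts n"
    and "v = up_shift n v3 \<or> v \<notin> up_shift n ` sg_verts n \<and> v3 \<notin> sg_verts n"
  shows "coeff (type_poly (Suc n) v t) j =
    glue_avg t (\<lambda>t1 t2 t3. coeff (type_poly n v t1 * type_poly n v2 t2 * type_poly n v3 t3) j)"
proof -
  have poly: "degree_poly n u s = smult (forest_count n s) (type_poly n u s)" for u s
    using forest_count_pos[of n s] by (simp add: type_poly_def)
  have "coeff (type_poly (Suc n) v t) j = (\<Sum>(t1, t2, t3)\<in>glue_set t.
    coeff (degree_poly n v t1 * degree_poly n v2 t2 * degree_poly n v3 t3) j / forest_count (Suc n) t)"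
    unfolding type_poly_def[of "Suc n"] degree_poly_Suc[OF assms]
    by (simp add: coeff_sum sum_divide_distrib case_prod_beta)
  also have "\<dots> = glue_avg t (\<lambda>t1 t2 t3. coeff (type_poly n v t1 * type_poly n v2 t2 * type_poly n v3 t3) j)"
    unfolding glue_avg_def
  proof (rule sum.cong[OF refl], clarify)
    fix t1 t2 t3 assume g: "(t1, t2, t3) \<in> glue_set t"
    show "coeff (degree_poly n v t1 * degree_poly n v2 t2 * degree_poly n v3 t3) j / forest_count (Suc n) t =
      type_weight t1 * type_weight t2 * type_weight t3 / type_total t *
      coeff (type_poly n v t1 * type_poly n v2 t2 * type_poly n v3 t3) j"
      unfolding forest_count_ratio[OF g, of n, symmetric] poly by (simp add: mult_ac)
  qed
  finally show ?thesis .
qed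

section \<open>Degree limits\<close>

text \<open>Strict bounds on both coordinates keep \<open>v\<close> off the other two copies, so
  only the type of the lower-left copy matters.\<close>

lemma coeff_type_poly_lower_left:
  assumes "fst v < 2 ^ n" "snd v < 2 ^ n"
  shows "coeff (type_poly (Suc n) v t) j = glue_avg t (\<lambda>s _ _. coeff (type_poly n v s) j)"
proof -
  \<comment> \<open>The placeholder vertex: its coordinate sum exceeds the bound
    \<open>2 ^ n\<close> for stage \<open>n\<close>.\<close>
  have out: "(Suc (2 ^ n), 0) \<notin> sg_verts n" using sg_verts_bound[of "(Suc (2 ^ n), 0)" n] by auto
  have "v \<notin> right_shift n ` sg_verts n" "v \<notin> up_shift n ` sg_verts n" using assms by auto
  then show ?thesis
    using coeff_type_poly_Suc[of v n "(Suc (2 ^ n), 0)" "(Suc (2 ^ n), 0)" t j] out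
    by (simp add: type_poly_outside)
qed

lemma coeff_type_poly_right_corner:
  "coeff (type_poly (Suc n) (2 ^ Suc n, 0) t) j = glue_avg t (\<lambda>_ s _. coeff (type_poly n (2 ^ n, 0) s) j)"
proof -
  have out: "(2 ^ Suc n, 0) \<notin> sg_verts n" "(Suc (2 ^ n), 0) \<notin> sg_verts n"
    using sg_verts_bound[of "(2 ^ Suc n, 0)" n] sg_verts_bound[of "(Suc (2 ^ n), 0)" n] by auto
  have "(2 ^ Suc n, 0) = right_shift n (2 ^ n, 0)" "(2 ^ Suc n, 0) \<notin> up_shift n ` sg_verts n"
    by auto
  then have "coeff (type_poly (Suc n) (2 ^ Suc n, 0) t) j = glue_avg t (\<lambda>t1 t2 t3.
    coeff (type_poly n (2 ^ Suc n, 0) t1 * type_poly n (2 ^ n, 0) t2 * type_poly n (Suc (2 ^ n), 0) t3) j)"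
    using out(2) by (intro coeff_type_poly_Suc) blast+
  then show ?thesis unfolding type_poly_outside[OF out(1)] type_poly_outside[OF out(2)] by simp
qed

lemma coeff_type_poly_top_corner:
  "coeff (type_poly (Suc n) (0, 2 ^ Suc n) t) j = glue_avg t (\<lambda>_ _ s. coeff (type_poly n (0, 2 ^ n) s) j)"
proof -
  have out: "(0, 2 ^ Suc n) \<notin> sg_verts n" "(Suc (2 ^ n), 0) \<notin> sg_verts n"
    using sg_verts_bound[of "(0, 2 ^ Suc n)" n] sg_verts_bound[of "(Suc (2 ^ n), 0)" n] by auto
  have "(0, 2 ^ Suc n) = up_shift n (0, 2 ^ n)" "(0, 2 ^ Suc n) \<notin> right_shift n ` sg_verts n"
    by auto
  then have "coeff (type_poly (Suc n) (0, 2 ^ Suc n) t) j = glue_avg t (\<lambda>t1 t2 t3.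
    coeff (type_poly n (0, 2 ^ Suc n) t1 * type_poly n (Suc (2 ^ n), 0) t2 * type_poly n (0, 2 ^ n) t3) j)"
    using out(2) by (intro coeff_type_poly_Suc) blast+
  then show ?thesis unfolding type_poly_outside[OF out(1)] type_poly_outside[OF out(2)] by simp
qed

text \<open>The stationary average of the degree law in a triangle: 11/14 = 9/14 * 2/3 + 5/28 + 5/28
  and 3/14 = 9/14 * 1/3.\<close>

definition limit_degree :: "nat \<Rightarrow> real" where
  "limit_degree j = (if j = 1 then 11 / 14 else if j = 2 then 3 / 14 else 0)"

lemma limit_degree_bounds: "0 \<le> limit_degree j" "limit_degree j \<le> 1"
  by (auto simp: limit_degree_def)

lemma degree_in_insert:
  assumes "finite T" "e \<notin> T"
  shows "degree_in (insert e T) v = (if v \<in> e then 1 else 0) + degree_in T v"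
proof (cases "v \<in> e")
  case True
  then have eq: "{f \<in> insert e T. v \<in> f} = insert e {f \<in> T. v \<in> f}" by auto
  show ?thesis unfolding degree_in_def eq using assms True by simp
next
  case False
  then have eq: "{f \<in> insert e T. v \<in> f} = {f \<in> T. v \<in> f}" by auto
  show ?thesis unfolding degree_in_def eq using False by simp
qed

lemma degree_in_empty: "degree_in {} v = 0"
  by (simp add: degree_in_def)

text \<open>Of the three spanning trees of a triangle, two meet a given corner in one edge and one
  in two edges; a forest with two blocks is a single edge.\<close>

lemma coeff_type_poly_0:
  assumes "v \<in> {(0, 0), (1, 0), (0, 1)}"
  shows "coeff (type_poly 0 v Joined) j = (if j = 1 then 2 / 3 else if j = 2 then 1 / 3 else 0)"
    and "v \<noteq> (0, 0) \<Longrightarrow> coeff (type_poly 0 v Apart0) j = (if j = 1 then 1 else 0)"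
    and "v \<noteq> (1, 0) \<Longrightarrow> coeff (type_poly 0 v Apart1) j = (if j = 1 then 1 else 0)"
    and "v \<noteq> (0, 1) \<Longrightarrow> coeff (type_poly 0 v Apart2) j = (if j = 1 then 1 else 0)"
proof -
  have double: "coeff (2 * p) i = 2 * coeff p i" for p :: "real poly" and i
    by (simp only: mult_2 coeff_add)
  have v: "v = (0, 0) \<or> v = (1, 0) \<or> v = (0, 1)" using assms by simp
  show "coeff (type_poly 0 v Joined) j = (if j = 1 then 2 / 3 else if j = 2 then 1 / 3 else 0)"
    using v by (elim disjE) (simp_all add: type_poly_def degree_poly_def sg_forests_0 forest_count_0
      doubleton_eq_iff degree_in_insert degree_in_empty coeff_monom double)
  have single: "coeff (type_poly 0 v t) j = (if j = 1 then 1 else 0)"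
    if "sg_forests 0 t = {{e}}" "v \<in> e" for t e
  proof -
    have "degree_in {e} v = 1" using that(2) by (simp add: degree_in_insert degree_in_empty)
    then have "degree_poly 0 v t = monom 1 1" "forest_count 0 t = 1"
      using that(1) by (simp_all add: degree_poly_def forest_count_def)
    then show ?thesis by (simp add: type_poly_def)
  qed
  show "coeff (type_poly 0 v Apart0) j = (if j = 1 then 1 else 0)" if "v \<noteq> (0, 0)"
    by (rule single[OF sg_forests_0(2)]) (use v that in blast)
  show "coeff (type_poly 0 v Apart1) j = (if j = 1 then 1 else 0)" if "v \<noteq> (1, 0)"
    by (rule single[OF sg_forests_0(3)]) (use v that in blast)
  show "coeff (type_poly 0 v Apart2) j = (if j = 1 then 1 else 0)" if "v \<noteq> (0, 1)"
    by (rule single[OF sg_forests_0(4)]) (use v that in blast)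
qed

text \<open>For each corner, the averaging matrix has a stationary distribution charging only the three
  types in which that corner is not isolated.\<close>

lemma corner_degree_limit:
  assumes "v \<in> {(0, 0), (2 ^ n, 0), (0, 2 ^ n)}"
  shows "\<bar>coeff (type_poly n v t) j - limit_degree j\<bar> \<le> (9 / 10) ^ n"
proof -
  \<comment> \<open>The weights solve the stationarity equation
    \<open>p = 2/3 * p + 6/10 * (q + q)\<close> with \<open>p + 2 * q = 1\<close>, where
    \<open>p\<close> belongs to \<open>Joined\<close> and \<open>q\<close> to the other two
    types.\<close>
  have initial: "9 / 14 * coeff (type_poly 0 u Joined) j + 5 / 28 * coeff (type_poly 0 u p) j +
      5 / 28 * coeff (type_poly 0 u q) j = limit_degree j"
    if "(u, p, q) \<in> {((0, 0), Apart1, Apart2), ((1, 0), Apart0, Apart2), ((0, 1), Apart0, Apart1)}" for u p q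
    using that by (auto simp: coeff_type_poly_0 limit_degree_def)
  note bounds = coeff_type_poly_bounds
  have "\<bar>coeff (type_poly n (0, 0) t) j - limit_degree j\<bar> \<le> (9 / 10) ^ n"
  proof (rule averaging_converges)
    have rec: "coeff (type_poly (Suc n) (0, 0) t) j = glue_avg t (\<lambda>s _ _. coeff (type_poly n (0, 0) s) j)" for n t
      by (rule coeff_type_poly_lower_left) auto
    show "9 / 14 * coeff (type_poly n (0, 0) Joined) j + 5 / 28 * coeff (type_poly n (0, 0) Apart1) j +
        5 / 28 * coeff (type_poly n (0, 0) Apart2) j = limit_degree j" for n
    proof (induction n)
      case (Suc n)
      then show ?case unfolding rec glue_avg_marginal1 by argo
    qed (rule initial, simp)
    show "coeff (type_poly n (0, 0) Joined) j / 10 + 9 / 10 * l \<le> coeff (type_poly (Suc n) (0, 0) t) j \<and>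
        coeff (type_poly (Suc n) (0, 0) t) j \<le> coeff (type_poly n (0, 0) Joined) j / 10 + 9 / 10 * u"
      if "\<And>s. l \<le> coeff (type_poly n (0, 0) s) j \<and> coeff (type_poly n (0, 0) s) j \<le> u" for n l u t
      unfolding rec by (rule glue_avg_contracts(1)) (rule that)
  qed (use bounds in auto)
  moreover have "\<bar>coeff (type_poly n (2 ^ n, 0) t) j - limit_degree j\<bar> \<le> (9 / 10) ^ n"
  proof (rule averaging_converges[where D = "\<lambda>n t. coeff (type_poly n (2 ^ n, 0) t) j"])
    show "9 / 14 * coeff (type_poly n (2 ^ n, 0) Joined) j + 5 / 28 * coeff (type_poly n (2 ^ n, 0) Apart0) j +
        5 / 28 * coeff (type_poly n (2 ^ n, 0) Apart2) j = limit_degree j" for n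
    proof (induction n)
      case 0
      show ?case unfolding power_0 by (rule initial) simp
    next
      case (Suc n)
      then show ?case unfolding coeff_type_poly_right_corner glue_avg_marginal2 by argo
    qed
    show "coeff (type_poly n (2 ^ n, 0) Joined) j / 10 + 9 / 10 * l \<le> coeff (type_poly (Suc n) (2 ^ Suc n, 0) t) j \<and>
        coeff (type_poly (Suc n) (2 ^ Suc n, 0) t) j \<le> coeff (type_poly n (2 ^ n, 0) Joined) j / 10 + 9 / 10 * u"
      if "\<And>s. l \<le> coeff (type_poly n (2 ^ n, 0) s) j \<and> coeff (type_poly n (2 ^ n, 0) s) j \<le> u" for n l u t
      unfolding coeff_type_poly_right_corner by (rule glue_avg_contracts(2)) (rule that)
  qed (use bounds in auto)
  moreover have "\<bar>coeff (type_poly n (0, 2 ^ n) t) j - limit_degree j\<bar> \<le> (9 / 10) ^ n"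
  proof (rule averaging_converges[where D = "\<lambda>n t. coeff (type_poly n (0, 2 ^ n) t) j"])
    show "9 / 14 * coeff (type_poly n (0, 2 ^ n) Joined) j + 5 / 28 * coeff (type_poly n (0, 2 ^ n) Apart0) j +
        5 / 28 * coeff (type_poly n (0, 2 ^ n) Apart1) j = limit_degree j" for n
    proof (induction n)
      case 0
      show ?case unfolding power_0 by (rule initial) simp
    next
      case (Suc n)
      then show ?case unfolding coeff_type_poly_top_corner glue_avg_marginal3 by argo
    qed
    show "coeff (type_poly n (0, 2 ^ n) Joined) j / 10 + 9 / 10 * l \<le> coeff (type_poly (Suc n) (0, 2 ^ Suc n) t) j \<and>
        coeff (type_poly (Suc n) (0, 2 ^ Suc n) t) j \<le> coeff (type_poly n (0, 2 ^ n) Joined) j / 10 + 9 / 10 * u"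
      if "\<And>s. l \<le> coeff (type_poly n (0, 2 ^ n) s) j \<and> coeff (type_poly n (0, 2 ^ n) s) j \<le> u" for n l u t
      unfolding coeff_type_poly_top_corner by (rule glue_avg_contracts(3)) (rule that)
  qed (use bounds in auto)
  ultimately show ?thesis using assms by auto
qed

text \<open>The law of the sum of two independent degrees distributed by
  \<open>limit_degree\<close>.\<close>

definition limit_junction :: "nat \<Rightarrow> real" where
  "limit_junction j = (\<Sum>i\<le>j. limit_degree i * limit_degree (j - i))"

lemma coeff_mult_near:
  fixes p q :: "real poly"
  assumes p: "\<And>i. \<bar>coeff p i - limit_degree i\<bar> \<le> e" "\<And>i. \<bar>coeff p i\<bar> \<le> 1"
    and q: "\<And>i. \<bar>coeff q i - limit_degree i\<bar> \<le> e"
  shows "\<bar>coeff (p * q) j - limit_junction j\<bar> \<le> 2 * real (Suc j) * e"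
proof -
  \<comment> \<open>One factor is exchanged at a time. Each of the \<open>j + 1\<close> summands
    then differs by at most \<open>2 * e\<close>, as coefficients and limits are at most 1 in
    absolute value.\<close>
  have "coeff (p * q) j - limit_junction j =
    (\<Sum>i\<le>j. coeff p i * (coeff q (j - i) - limit_degree (j - i)) + (coeff p i - limit_degree i) * limit_degree (j - i))"
    unfolding coeff_mult limit_junction_def sum_subtractf[symmetric]
    by (rule sum.cong) (simp_all add: algebra_simps)
  also have "\<bar>\<dots>\<bar> \<le> (\<Sum>i\<le>j. 2 * e)"
  proof (rule order_trans[OF sum_abs sum_mono])
    fix i
    have "\<bar>coeff p i * (coeff q (j - i) - limit_degree (j - i))\<bar> \<le> 1 * e"
      unfolding abs_mult using p q by (intro mult_mono) auto
    moreover have "\<bar>(coeff p i - limit_degree i) * limit_degree (j - i)\<bar> \<le> e * 1"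
      unfolding abs_mult using p limit_degree_bounds[of "j - i"] order_trans[OF abs_ge_zero p(1)]
      by (intro mult_mono) auto
    ultimately show "\<bar>coeff p i * (coeff q (j - i) - limit_degree (j - i)) +
        (coeff p i - limit_degree i) * limit_degree (j - i)\<bar> \<le> 2 * e"
      by linarith
  qed
  finally show ?thesis by (simp add: algebra_simps)
qed

text \<open>The types of the two copies meeting at \<open>x\<close> are correlated, but for every
  single choice of types the product of the corner laws is already close to
  \<open>limit_junction\<close>; hence so is any average over types.\<close>

lemma junction_degree_limit:
  assumes "x \<in> {a_vertex n, b_vertex n, c_vertex n}"
  shows "\<bar>coeff (type_poly (Suc n) x t) j - limit_junction j\<bar> \<le> 2 * real (Suc j) * (9 / 10) ^ n"
proof -
  have prod: "\<bar>coeff (type_poly n u s * type_poly n v s') j - limit_junction j\<bar> \<le> 2 * real (Suc j) * (9 / 10) ^ n"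
    if "u \<in> {(0, 0), (2 ^ n, 0), (0, 2 ^ n)}" "v \<in> {(0, 0), (2 ^ n, 0), (0, 2 ^ n)}" for u v s s'
    using corner_degree_limit[OF that(1)] corner_degree_limit[OF that(2)] coeff_type_poly_bounds
    by (intro coeff_mult_near) (auto simp: abs_le_iff intro: order_trans[of _ 0])
  have out: "(Suc (2 ^ n), 0) \<notin> sg_verts n" "(2 ^ n, 2 ^ n) \<notin> sg_verts n"
    using sg_verts_bound[of "(Suc (2 ^ n), 0)" n] sg_verts_bound[of "(2 ^ n, 2 ^ n)" n] by auto
  consider "x = (2 ^ n, 0)" | "x = (0, 2 ^ n)" | "x = (2 ^ n, 2 ^ n)"
    using assms by (auto simp: a_vertex_def b_vertex_def c_vertex_def)
  then show ?thesis
  proof cases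
    case 1
    have "x = right_shift n (0, 0)" "x \<notin> up_shift n ` sg_verts n" using 1 by auto
    then have "coeff (type_poly (Suc n) x t) j =
      glue_avg t (\<lambda>t1 t2 t3. coeff (type_poly n x t1 * type_poly n (0, 0) t2 * type_poly n (Suc (2 ^ n), 0) t3) j)"
      using out by (intro coeff_type_poly_Suc) auto
    then show ?thesis
      unfolding type_poly_outside[OF out(1)] mult_1_right
      by (elim ssubst) (intro glue_avg_bounds prod; simp add: 1)
  next
    case 2
    have "x = up_shift n (0, 0)" "x \<notin> right_shift n ` sg_verts n" using 2 by auto
    then have "coeff (type_poly (Suc n) x t) j =
      glue_avg t (\<lambda>t1 t2 t3. coeff (type_poly n x t1 * type_poly n (Suc (2 ^ n), 0) t2 * type_poly n (0, 0) t3) j)"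
      using out by (intro coeff_type_poly_Suc) auto
    then show ?thesis
      unfolding type_poly_outside[OF out(1)] mult_1_right
      by (elim ssubst) (intro glue_avg_bounds prod; simp add: 2)
  next
    case 3
    have "x = right_shift n (0, 2 ^ n)" "x = up_shift n (2 ^ n, 0)" using 3 by auto
    then have eq: "coeff (type_poly (Suc n) x t) j =
      glue_avg t (\<lambda>t1 t2 t3. coeff (type_poly n x t1 * type_poly n (0, 2 ^ n) t2 * type_poly n (2 ^ n, 0) t3) j)"
      by (intro coeff_type_poly_Suc) auto
    \<comment> \<open>\<open>c_vertex n\<close> lies outside the lower-left copy, which therefore
      contributes the factor 1.\<close>
    have "type_poly n x s = 1" for s unfolding 3 by (rule type_poly_outside[OF out(2)])
    then show ?thesis
      unfolding eq by (simp only: mult_1_left) (intro glue_avg_bounds prod; simp)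
  qed
qed

lemma deg_prob_eq: "deg_prob j N x = coeff (type_poly N x Joined) j"
  unfolding deg_prob_def tree_count_deg_def tree_count_def spanning_trees_sg type_poly_def
    coeff_smult coeff_degree_poly forest_count_def degree_in_def by simp

text \<open>From stage \<open>n + 1\<close> on, \<open>x\<close> is no outer corner other than
  possibly the origin, and its coordinates, at most \<open>2 ^ n\<close>, stay strictly below those
  of the next junctions on the axes.\<close>

lemma junction_step:
  assumes "x \<in> {a_vertex n, b_vertex n, c_vertex n}"
  shows "coeff (type_poly (Suc (Suc n + m)) x t) j = glue_avg t (\<lambda>s _ _. coeff (type_poly (Suc n + m) x s) j)"
proof (rule coeff_type_poly_lower_left)
  have "(2 :: nat) ^ n < 2 ^ (Suc n + m)" by (rule power_strict_increasing) auto
  then show "fst x < 2 ^ (Suc n + m)" "snd x < 2 ^ (Suc n + m)"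
    using assms by (auto simp: a_vertex_def b_vertex_def c_vertex_def simp del: power_Suc)
qed

lemma deg_prob_near:
  assumes "x \<in> {a_vertex n, b_vertex n, c_vertex n}"
  shows "\<bar>deg_prob j (n + m + 1) x - limit_junction j\<bar> \<le> 2 * real (Suc j) * (9 / 10) ^ n"
proof -
  \<comment> \<open>The induction covers all types, because the average for \<open>Joined\<close>
    draws on the others.\<close>
  have "\<bar>coeff (type_poly (Suc n + m) x t) j - limit_junction j\<bar> \<le> 2 * real (Suc j) * (9 / 10) ^ n" for t
  proof (induction m arbitrary: t)
    case 0
    then show ?case using junction_degree_limit[OF assms] by simp
  next
    case (Suc m)
    then show ?case unfolding add_Suc_right junction_step[OF assms] by (intro glue_avg_bounds)
  qed
  then show ?thesis by (simp add: deg_prob_eq add.commute)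
qed

text \<open>The contraction argument again, now started at stage \<open>n + 1\<close>. The limit is
  the stationary average \<open>L\<close> of the values there, which in general differs from
  \<open>limit_junction j\<close>.\<close>

lemma deg_prob_convergent:
  assumes "x \<in> {a_vertex n, b_vertex n, c_vertex n}"
  shows "convergent (\<lambda>m. deg_prob j (n + m + 1) x)"
proof -
  define D where "D = (\<lambda>m t. coeff (type_poly (Suc n + m) x t) j)"
  have rec: "D (Suc m) t = glue_avg t (\<lambda>s _ _. D m s)" for m t
    unfolding D_def add_Suc_right by (rule junction_step[OF assms])
  define L where "L = 9 / 14 * D 0 Joined + 5 / 28 * D 0 Apart1 + 5 / 28 * D 0 Apart2"
  have "\<bar>D m Joined - L\<bar> \<le> (9 / 10) ^ m" for m
  proof (rule averaging_converges)
    show "9 / 14 * D m Joined + 5 / 28 * D m Apart1 + 5 / 28 * D m Apart2 = L" for m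
    proof (induction m)
      case (Suc m)
      then show ?case unfolding rec glue_avg_marginal1 by argo
    qed (simp add: L_def)
    show "D m Joined / 10 + 9 / 10 * l \<le> D (Suc m) t \<and> D (Suc m) t \<le> D m Joined / 10 + 9 / 10 * u"
      if "\<And>s. l \<le> D m s \<and> D m s \<le> u" for m l u t
      unfolding rec by (rule glue_avg_contracts(1)) (rule that)
  qed (auto simp: D_def coeff_type_poly_bounds)
  then have "\<forall>\<^sub>F m in sequentially. norm (D m Joined - L) \<le> (9 / 10) ^ m" by simp
  moreover have "(\<lambda>m. (9 / 10 :: real) ^ m) \<longlonglongrightarrow> 0" by (rule LIMSEQ_realpow_zero) simp_all
  ultimately have "(\<lambda>m. D m Joined - L) \<longlonglongrightarrow> 0" by (rule Lim_null_comparison)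
  then have "(\<lambda>m. D m Joined) \<longlonglongrightarrow> L" by (rule LIM_zero_cancel)
  then have "convergent (\<lambda>m. D m Joined)" by (rule convergentI)
  moreover have "D m Joined = deg_prob j (n + m + 1) x" for m by (simp add: deg_prob_eq D_def)
  ultimately show ?thesis by simp
qed

lemma near_tendsto_0: "(\<lambda>n. 2 * real (Suc j) * (9 / 10) ^ n) \<longlonglongrightarrow> 0"
  by (intro tendsto_mult_right_zero LIMSEQ_realpow_zero) auto

text \<open>The bound of \<open>deg_prob_near\<close> involves neither \<open>m\<close> nor the
  choice among the three vertices, so one threshold for \<open>n\<close> serves for all
  \<open>m\<close>.\<close>

lemma deg_prob_uniform_limit:
  assumes "\<And>n. x n \<in> {a_vertex n, b_vertex n, c_vertex n}"
  shows "uniform_limit UNIV (\<lambda>n m. deg_prob j (n + m + 1) (x n)) (\<lambda>m. limit_junction j) sequentially"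
proof (rule uniform_limitI)
  fix e :: real assume "e > 0"
  then have "\<forall>\<^sub>F n in sequentially. 2 * real (Suc j) * (9 / 10) ^ n < e"
    using near_tendsto_0 by (rule order_tendstoD(2)[rotated])
  then show "\<forall>\<^sub>F n in sequentially. \<forall>m\<in>UNIV. dist (deg_prob j (n + m + 1) (x n)) (limit_junction j) < e"
    unfolding dist_real_def by eventually_elim (blast intro: order_le_less_trans deg_prob_near[OF assms])
qed

text \<open>The bound of \<open>deg_prob_near\<close> is a closed condition and survives the limit
  in \<open>m\<close>; afterwards \<open>n\<close> tends to infinity.\<close>

lemma deg_prob_iterated_limit:
  assumes "\<And>n. x n \<in> {a_vertex n, b_vertex n, c_vertex n}"
  shows "(\<lambda>n. lim (\<lambda>m. deg_prob j (n + m + 1) (x n))) \<longlonglongrightarrow> limit_junction j"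
proof -
  have "\<bar>lim (\<lambda>m. deg_prob j (n + m + 1) (x n)) - limit_junction j\<bar> \<le> 2 * real (Suc j) * (9 / 10) ^ n" for n
  proof (rule LIMSEQ_le_const2)
    have "(\<lambda>m. deg_prob j (n + m + 1) (x n)) \<longlonglongrightarrow> lim (\<lambda>m. deg_prob j (n + m + 1) (x n))"
      using deg_prob_convergent[OF assms] convergent_LIMSEQ_iff by blast
    then show "(\<lambda>m. \<bar>deg_prob j (n + m + 1) (x n) - limit_junction j\<bar>) \<longlonglongrightarrow>
        \<bar>lim (\<lambda>m. deg_prob j (n + m + 1) (x n)) - limit_junction j\<bar>"
      by (intro tendsto_intros)
  qed (use deg_prob_near[OF assms] in blast)
  then have "(\<lambda>n. lim (\<lambda>m. deg_prob j (n + m + 1) (x n)) - limit_junction j) \<longlonglongrightarrow> 0"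
    by (intro Lim_null_comparison[OF _ near_tendsto_0[of j]]) auto
  then show ?thesis by (rule LIM_zero_cancel)
qed

lemma limit_junction_values:
  "limit_junction 1 = 0" "limit_junction 2 = 121 / 196" "limit_junction 3 = 33 / 98" "limit_junction 4 = 9 / 196"
  by (simp_all add: limit_junction_def limit_degree_def eval_nat_numeral)

text \<open>The stated values are taken in the regime where \<open>n\<close> grows as well. Since
  \<open>lim\<close> is total, the convergence clause is what gives the iterated limits their
  meaning; the uniform clauses cover every way of letting \<open>m\<close> vary while
  \<open>n\<close> tends to infinity. The choice among the three vertices may change with
  \<open>n\<close>.\<close>

theorem mainTheorem5:
  fixes x :: "nat \<Rightarrow> vertex"
  assumes "\<And>n. x n \<in> {a_vertex n, b_vertex n, c_vertex n}"
  shows "(\<forall>j\<in>{1..4}. \<forall>n. convergent (\<lambda>m. deg_prob j (n + m + 1) (x n)))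
    \<and> (\<lambda>n. lim (\<lambda>m. deg_prob 1 (n + m + 1) (x n))) \<longlonglongrightarrow> 0
    \<and> (\<lambda>n. lim (\<lambda>m. deg_prob 2 (n + m + 1) (x n))) \<longlonglongrightarrow> 121 / 196
    \<and> (\<lambda>n. lim (\<lambda>m. deg_prob 3 (n + m + 1) (x n))) \<longlonglongrightarrow> 33 / 98
    \<and> (\<lambda>n. lim (\<lambda>m. deg_prob 4 (n + m + 1) (x n))) \<longlonglongrightarrow> 9 / 196
    \<and> uniform_limit UNIV (\<lambda>n m. deg_prob 1 (n + m + 1) (x n)) (\<lambda>m. 0) sequentially
    \<and> uniform_limit UNIV (\<lambda>n m. deg_prob 2 (n + m + 1) (x n)) (\<lambda>m. 121 / 196) sequentially
    \<and> uniform_limit UNIV (\<lambda>n m. deg_prob 3 (n + m + 1) (x n)) (\<lambda>m. 33 / 98) sequentially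
    \<and> uniform_limit UNIV (\<lambda>n m. deg_prob 4 (n + m + 1) (x n)) (\<lambda>m. 9 / 196) sequentially"
  unfolding limit_junction_values[symmetric]
  by (intro conjI ballI allI deg_prob_convergent deg_prob_iterated_limit deg_prob_uniform_limit assms)

end
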